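(* The induced functor $\mathbf G_{\mathrm{sc}}\to(\mathbf U_0)_{/\mathfrak o}$, obtained by restricting the functor $\mathbf G\to\mathbf U_{/\mathfrak o}$ to simply-connected graphs, is an equivalence of categories.
   Context: **Directed graphs.** A directed graph $G$ consists of finite sets $E_G,I_G,V_G,O_G$, inclusions $I_G,O_G\subseteq E_G$ and functions $I_G\to V_G$, $O_G\to V_G$. For $v\in V_G$, $\mathrm{in}(v)\subseteq I_G$ and $\mathrm{out}(v)\subseteq O_G$ are the preimages of $v$; $\mathrm{in}(G)=E_G\setminus O_G$, $\mathrm{out}(G)=E_G\setminus I_G$. Connected means non-empty and not a disjoint union of two non-empty directed graphs. $G$ is simply-connected (a directed tree) if it is connected and its underlying undirected graph is a tree; equivalently $G$ is connected and either $V_G=\varnothing$ or $|I_G\cap O_G|=|V_G|-1$. An étale map is a natural transformation of diagrams $(E,I,V,O)$ such that the squares for $I\to V$ and $O\to V$ are pullbacks; an embedding is an étale map between connected directed graphs that is injective on vertices. $\mathrm{Emb}(G)$ is the set of classes $[f]$ of embeddings with codomain $G$ ($f\sim h$ iff $f=hz$, $z$ an isomorphism), ordered by $[h]\le[k]$ iff $h=kj$ for some embedding $j$. A class $[f\colon H\to G]$ is an edge if $V_H=\varnothing$. $\mathbb NS$ is the free commutative monoid on $S$; $\mathrm{in}([f])=\sum_{e\in\mathrm{in}(H)}f(e)$, $\mathrm{out}([f])=\sum_{e\in\mathrm{out}(H)}f(e)$ in $\mathbb NE_G$. **$\mathbf U_{/\mathfrak o}$ and $(\mathbf U_0)_{/\mathfrak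 o}$.** $\mathbf U_{/\mathfrak o}$ has as objects connected directed graphs. A morphism $G\to G'$ is a pair of functions $\bar\varphi_0\colon E_G\to E_{G'}$, $\hat\varphi\colon\mathrm{Emb}(G)\to\mathrm{Emb}(G')$ such that: (i) $\hat\varphi$ sends edges to edges; (ii) if $[\ell]$ is a union of $[h]$ and $[k]$, then $\hat\varphi[\ell]$ is a union of $\hat\varphi[h]$ and $\hat\varphi[k]$; (iii) $\hat\varphi$ takes vertex disjoint pairs to vertex disjoint pairs; (iv) $\mathrm{in}(\hat\varphi[h])=(\mathbb N\bar\varphi_0)(\mathrm{in}[h])$ and $\mathrm{out}(\hat\varphi[h])=(\mathbb N\bar\varphi_0)(\mathrm{out}[h])$ for all $[h]$. Here $\ell\colon L\to G$ is a union of $h\colon H\to G$ and $k\colon K\to G$ if $[h],[k]\le[\ell]$ and $\ell(V_L)=h(V_H)\cup k(V_K)$; $h,k$ are vertex disjoint if $h(V_H)\cap k(V_K)=\varnothing$. Composition is composition of pairs. $(\mathbf U_0)_{/\mathfrak o}$ is the full subcategory on directed trees. **$\mathbf G$ and $\mathbf G_{\mathrm{sc}}$.** A directed path in $G$ is a sequence $e_0v_1e_1\cdots v_ne_n$ ($n\ge0$) with $e_{i-1}\in\mathrm{in}(v_i)$, $e_i\in\mathrm{out}(v_i)$. $G$ is acyclic if it is connected and no directed path with $n\ge1$ has $e_0=e_n$. For $G$ acyclic, an embedding $h\colon H\to G$ is a convex inclusion if it is injective (on edges and vertices) and every directed path in $G$ whose first and last edges are in the image of $h$ has all its edges and vertices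 in the image of $h$. $\mathrm{sSb}(G)\subseteq\mathrm{Emb}(G)$ is the set of classes of convex inclusions; each element $H$ is identified with its image, a pair of subsets $E_H\subseteq E_G$, $V_H\subseteq V_G$, and $H_1\cup H_2$ denotes the subgraph given by the unions of these subsets. $\mathbf G$ has objects the acyclic directed graphs; a morphism $G\to G'$ is a pair of functions $\bar\varphi_0\colon E_G\to E_{G'}$, $\check\varphi\colon\mathrm{sSb}(G)\to\mathrm{sSb}(G')$ such that (1) $\mathrm{in}(\check\varphi(H))=(\mathbb N\bar\varphi_0)(\mathrm{in}(H))$ and $\mathrm{out}(\check\varphi(H))=(\mathbb N\bar\varphi_0)(\mathrm{out}(H))$ for all $H$; (2) if $H_1,H_2,H_1\cup H_2\in\mathrm{sSb}(G)$, then $\check\varphi(H_1\cup H_2)=\check\varphi(H_1)\cup\check\varphi(H_2)$. Composition is composition of pairs. $\mathbf G_{\mathrm{sc}}\subset\mathbf G$ is the full subcategory on the directed trees. **The functor.** The functor $\mathbf G\to\mathbf U_{/\mathfrak o}$ is the identity on objects and sends $(\bar\varphi_0,\check\varphi)$ to the unique morphism $(\bar\varphi_0,\hat\varphi)$ of $\mathbf U_{/\mathfrak o}$ such that $\hat\varphi[\iota_v]=\check\varphi(\iota_v)$ for every vertex $v$ of $G$, where $[\iota_v]\in\mathrm{sSb}(G)\subseteq\mathrm{Emb}(G)$ is the class of the star embedding at $v$ (the domain of $\iota_v$ has the single vertex $v$ with inputs $\mathrm{in}(v)$ and outputs $\mathrm{out}(v)$). *)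

theory Defs
  imports "HOL-Library.FuncSet" "HOL-Library.Multiset" "HOL-Library.Infinite_Typeclass"
begin

section \<open>Categories, functors, equivalences\<close>

text \<open>Hom-sets of different pairs of objects need not be disjoint, so composition and the action of
  a functor on morphisms take the objects concerned as arguments. All laws are relative to
  \<open>Ob\<close> and \<open>Hom\<close>; in particular functors and natural transformations are arbitrary outside them.\<close>

record ('o, 'm) cat =
  Ob :: "'o set"
  Hom :: "'o \<Rightarrow> 'o \<Rightarrow> 'm set"
  Comp :: "'o \<Rightarrow> 'o \<Rightarrow> 'o \<Rightarrow> 'm \<Rightarrow> 'm \<Rightarrow> 'm"
  Ident :: "'o \<Rightarrow> 'm"

locale category =
  fixes C :: "('o, 'm) cat"
  assumes Ident_in_Hom: "a \<in> Ob C \<Longrightarrow> Ident C a \<in> Hom C a a"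
    and Comp_in_Hom: "\<lbrakk>a \<in> Ob C; b \<in> Ob C; c \<in> Ob C; f \<in> Hom C a b; g \<in> Hom C b c\<rbrakk>
        \<Longrightarrow> Comp C a b c g f \<in> Hom C a c"
    and Comp_Ident_left: "\<lbrakk>a \<in> Ob C; b \<in> Ob C; f \<in> Hom C a b\<rbrakk> \<Longrightarrow> Comp C a b b (Ident C b) f = f"
    and Comp_Ident_right: "\<lbrakk>a \<in> Ob C; b \<in> Ob C; f \<in> Hom C a b\<rbrakk> \<Longrightarrow> Comp C a a b f (Ident C a) = f"
    and Comp_assoc: "\<lbrakk>a \<in> Ob C; b \<in> Ob C; c \<in> Ob C; d \<in> Ob C;
          f \<in> Hom C a b; g \<in> Hom C b c; h \<in> Hom C c d\<rbrakk>
        \<Longrightarrow> Comp C a b d (Comp C b c d h g) f = Comp C a c d h (Comp C a b c g f)"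

definition full_subcat :: "('o, 'm) cat \<Rightarrow> ('o \<Rightarrow> bool) \<Rightarrow> ('o, 'm) cat" where
  "full_subcat C P = C\<lparr>Ob := {a \<in> Ob C. P a}\<rparr>"

record ('o, 'm, 'p, 'n) ftor =
  ob_map :: "'o \<Rightarrow> 'p"
  mor_map :: "'o \<Rightarrow> 'o \<Rightarrow> 'm \<Rightarrow> 'n"

locale cat_functor = C: category C + D: category D
  for C :: "('o, 'm) cat" and D :: "('p, 'n) cat" +
  fixes F :: "('o, 'm, 'p, 'n) ftor"
  assumes ob_map_in_Ob: "a \<in> Ob C \<Longrightarrow> ob_map F a \<in> Ob D"
    and mor_map_in_Hom: "\<lbrakk>a \<in> Ob C; b \<in> Ob C; f \<in> Hom C a b\<rbrakk>
        \<Longrightarrow> mor_map F a b f \<in> Hom D (ob_map F a) (ob_map F b)"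
    and mor_map_Ident: "a \<in> Ob C \<Longrightarrow> mor_map F a a (Ident C a) = Ident D (ob_map F a)"
    and mor_map_Comp: "\<lbrakk>a \<in> Ob C; b \<in> Ob C; c \<in> Ob C; f \<in> Hom C a b; g \<in> Hom C b c\<rbrakk>
        \<Longrightarrow> mor_map F a c (Comp C a b c g f)
          = Comp D (ob_map F a) (ob_map F b) (ob_map F c) (mor_map F b c g) (mor_map F a b f)"

definition id_ftor :: "('o, 'm, 'o, 'm) ftor" where
  "id_ftor = \<lparr>ob_map = (\<lambda>a. a), mor_map = (\<lambda>a b f. f)\<rparr>"

definition comp_ftor ::
  "('p, 'n, 'q, 'r) ftor \<Rightarrow> ('o, 'm, 'p, 'n) ftor \<Rightarrow> ('o, 'm, 'q, 'r) ftor" where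
  "comp_ftor G F = \<lparr>ob_map = (\<lambda>a. ob_map G (ob_map F a)),
     mor_map = (\<lambda>a b f. mor_map G (ob_map F a) (ob_map F b) (mor_map F a b f))\<rparr>"

definition cat_iso :: "('o, 'm) cat \<Rightarrow> 'o \<Rightarrow> 'o \<Rightarrow> 'm \<Rightarrow> bool" where
  "cat_iso C a b f \<longleftrightarrow> f \<in> Hom C a b \<and>
     (\<exists>g \<in> Hom C b a. Comp C a b a g f = Ident C a \<and> Comp C b a b f g = Ident C b)"

locale natural_iso = F: cat_functor C D F + G: cat_functor C D G
  for C :: "('o, 'm) cat" and D :: "('p, 'n) cat"
    and F G :: "('o, 'm, 'p, 'n) ftor" +
  fixes \<eta> :: "'o \<Rightarrow> 'n"
  assumes component_iso: "a \<in> Ob C \<Longrightarrow> cat_iso D (ob_map F a) (ob_map G a) (\<eta> a)"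
    and naturality: "\<lbrakk>a \<in> Ob C; b \<in> Ob C; f \<in> Hom C a b\<rbrakk>
        \<Longrightarrow> Comp D (ob_map F a) (ob_map F b) (ob_map G b) (\<eta> b) (mor_map F a b f)
          = Comp D (ob_map F a) (ob_map G a) (ob_map G b) (mor_map G a b f) (\<eta> a)"

locale cat_equivalence = cat_functor C D F
  for C :: "('o, 'm) cat" and D :: "('p, 'n) cat" and F :: "('o, 'm, 'p, 'n) ftor" +
  assumes ex_quasi_inverse: "\<exists>G. cat_functor D C G
      \<and> (\<exists>\<eta>. natural_iso C C id_ftor (comp_ftor G F) \<eta>)
      \<and> (\<exists>\<epsilon>. natural_iso D D (comp_ftor F G) id_ftor \<epsilon>)"


section \<open>Directed graphs\<close>

text \<open>\<open>tgt\<close> and \<open>src\<close> are the structure functions out of the sets \<open>inputs\<close> and \<open>outputs\<close>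
  (of edges that are an input, respectively an output, of some vertex); as functions on a set they
  are extensional, i.e. \<open>undefined\<close> elsewhere. The same convention applies to all maps below.\<close>

record ('e, 'v) dgraph =
  edges :: "'e set"
  inputs :: "'e set"
  verts :: "'v set"
  outputs :: "'e set"
  tgt :: "'e \<Rightarrow> 'v"
  src :: "'e \<Rightarrow> 'v"

definition digraph :: "('e, 'v) dgraph \<Rightarrow> bool" where
  "digraph G \<longleftrightarrow> finite (edges G) \<and> finite (verts G) \<and>
     inputs G \<subseteq> edges G \<and> outputs G \<subseteq> edges G \<and>
     tgt G \<in> inputs G \<rightarrow>\<^sub>E verts G \<and> src G \<in> outputs G \<rightarrow>\<^sub>E verts G"

definition in_edges :: "('e, 'v) dgraph \<Rightarrow> 'v \<Rightarrow> 'e set" where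
  "in_edges G v = {e \<in> inputs G. tgt G e = v}"

definition out_edges :: "('e, 'v) dgraph \<Rightarrow> 'v \<Rightarrow> 'e set" where
  "out_edges G v = {e \<in> outputs G. src G e = v}"

definition in_legs :: "('e, 'v) dgraph \<Rightarrow> 'e set" where
  "in_legs G = edges G - outputs G"

definition out_legs :: "('e, 'v) dgraph \<Rightarrow> 'e set" where
  "out_legs G = edges G - inputs G"

definition nonempty_graph :: "('e, 'v) dgraph \<Rightarrow> bool" where
  "nonempty_graph G \<longleftrightarrow> edges G \<noteq> {} \<or> verts G \<noteq> {}"

definition disjoint_union_of ::
  "('e, 'v) dgraph \<Rightarrow> ('e, 'v) dgraph \<Rightarrow> ('e, 'v) dgraph \<Rightarrow> bool" where
  "disjoint_union_of G A B \<longleftrightarrow>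
     edges A \<inter> edges B = {} \<and> verts A \<inter> verts B = {} \<and>
     edges G = edges A \<union> edges B \<and> verts G = verts A \<union> verts B \<and>
     inputs G = inputs A \<union> inputs B \<and> outputs G = outputs A \<union> outputs B \<and>
     (\<forall>e \<in> inputs A. tgt G e = tgt A e) \<and> (\<forall>e \<in> inputs B. tgt G e = tgt B e) \<and>
     (\<forall>e \<in> outputs A. src G e = src A e) \<and> (\<forall>e \<in> outputs B. src G e = src B e)"

definition connected_graph :: "('e, 'v) dgraph \<Rightarrow> bool" where
  "connected_graph G \<longleftrightarrow> digraph G \<and> nonempty_graph G \<and>
     (\<nexists>A B. digraph A \<and> digraph B \<and> nonempty_graph A \<and> nonempty_graph B \<and> disjoint_union_of G A B)"

text \<open>A cycle of length \<open>n \<ge> 1\<close> in the underlying undirected (multi)graph, whose edges with two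
  ends are the elements of \<open>inputs G \<inter> outputs G\<close>. Loops and pairs of parallel edges are cycles
  of length 1 and 2.\<close>

definition undirected_cycle :: "('e, 'v) dgraph \<Rightarrow> 'v list \<Rightarrow> 'e list \<Rightarrow> bool" where
  "undirected_cycle G vs es \<longleftrightarrow>
     length vs = length es \<and> es \<noteq> [] \<and> distinct vs \<and> distinct es \<and>
     (\<forall>i < length es. es ! i \<in> inputs G \<inter> outputs G \<and>
        {src G (es ! i), tgt G (es ! i)} = {vs ! i, vs ! (Suc i mod length es)})"

definition directed_tree :: "('e, 'v) dgraph \<Rightarrow> bool" where
  "directed_tree G \<longleftrightarrow> connected_graph G \<and> (\<nexists>vs es. undirected_cycle G vs es)"

text \<open>The path \<open>e\<^sub>0 v\<^sub>1 e\<^sub>1 \<dots> v\<^sub>n e\<^sub>n\<close> is given by \<open>es = [e\<^sub>0, \<dots>, e\<^sub>n]\<close> and \<open>vs = [v\<^sub>1, \<dots>, v\<^sub>n]\<close>.\<close>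

definition directed_path :: "('e, 'v) dgraph \<Rightarrow> 'e list \<Rightarrow> 'v list \<Rightarrow> bool" where
  "directed_path G es vs \<longleftrightarrow>
     length es = Suc (length vs) \<and> set es \<subseteq> edges G \<and> set vs \<subseteq> verts G \<and>
     (\<forall>i < length vs. es ! i \<in> in_edges G (vs ! i) \<and> es ! Suc i \<in> out_edges G (vs ! i))"

definition acyclic_graph :: "('e, 'v) dgraph \<Rightarrow> bool" where
  "acyclic_graph G \<longleftrightarrow> connected_graph G \<and>
     (\<nexists>es vs. directed_path G es vs \<and> vs \<noteq> [] \<and> hd es = last es)"


section \<open>Etale maps and embeddings\<close>

text \<open>A map \<open>H \<rightarrow> G\<close> is a pair of functions on edges and vertices: since \<open>inputs\<close> and \<open>outputs\<close>
  are subsets of \<open>edges\<close>, the two other components of a natural transformation are restrictions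
  of the first.\<close>

type_synonym ('e, 'v) gmap = "('e \<Rightarrow> 'e) \<times> ('v \<Rightarrow> 'v)"

definition graph_map :: "('e, 'v) dgraph \<Rightarrow> ('e, 'v) dgraph \<Rightarrow> ('e, 'v) gmap \<Rightarrow> bool" where
  "graph_map H G f \<longleftrightarrow>
     fst f \<in> edges H \<rightarrow>\<^sub>E edges G \<and> snd f \<in> verts H \<rightarrow>\<^sub>E verts G \<and>
     fst f ` inputs H \<subseteq> inputs G \<and> fst f ` outputs H \<subseteq> outputs G \<and>
     (\<forall>e \<in> inputs H. tgt G (fst f e) = snd f (tgt H e)) \<and>
     (\<forall>e \<in> outputs H. src G (fst f e) = snd f (src H e))"

text \<open>The pullback conditions say that the comparison maps to the set-theoretic fibre products
  are bijective.\<close>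

definition etale :: "('e, 'v) dgraph \<Rightarrow> ('e, 'v) dgraph \<Rightarrow> ('e, 'v) gmap \<Rightarrow> bool" where
  "etale H G f \<longleftrightarrow> graph_map H G f \<and>
     bij_betw (\<lambda>e. (fst f e, tgt H e)) (inputs H)
       {(e, v). e \<in> inputs G \<and> v \<in> verts H \<and> tgt G e = snd f v} \<and>
     bij_betw (\<lambda>e. (fst f e, src H e)) (outputs H)
       {(e, v). e \<in> outputs G \<and> v \<in> verts H \<and> src G e = snd f v}"

definition embedding :: "('e, 'v) dgraph \<Rightarrow> ('e, 'v) dgraph \<Rightarrow> ('e, 'v) gmap \<Rightarrow> bool" where
  "embedding H G f \<longleftrightarrow> connected_graph H \<and> connected_graph G \<and> etale H G f \<and>
     inj_on (snd f) (verts H)"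

definition graph_iso :: "('e, 'v) dgraph \<Rightarrow> ('e, 'v) dgraph \<Rightarrow> ('e, 'v) gmap \<Rightarrow> bool" where
  "graph_iso H G f \<longleftrightarrow> graph_map H G f \<and>
     bij_betw (fst f) (edges H) (edges G) \<and> bij_betw (fst f) (inputs H) (inputs G) \<and>
     bij_betw (fst f) (outputs H) (outputs G) \<and> bij_betw (snd f) (verts H) (verts G)"

definition comp_gmap ::
  "('e, 'v) dgraph \<Rightarrow> ('e, 'v) gmap \<Rightarrow> ('e, 'v) gmap \<Rightarrow> ('e, 'v) gmap" where
  "comp_gmap H g f = (compose (edges H) (fst g) (fst f), compose (verts H) (snd g) (snd f))"


section \<open>Classes of embeddings\<close>

text \<open>An embedding with codomain \<open>G\<close> is recorded together with its domain. Domains range over the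
  graphs with edges in \<open>'e\<close> and vertices in \<open>'v\<close>; if both types are infinite, these represent all
  isomorphism classes of finite directed graphs. (An embedding can identify two edges, so in
  general the domain is not a subgraph of \<open>G\<close>.)\<close>

type_synonym ('e, 'v) emb = "('e, 'v) dgraph \<times> ('e, 'v) gmap"

definition embeddings_into :: "('e, 'v) dgraph \<Rightarrow> ('e, 'v) emb set" where
  "embeddings_into G = {(H, f). embedding H G f}"

definition emb_rel :: "('e, 'v) dgraph \<Rightarrow> ('e, 'v) emb rel" where
  "emb_rel G = {((H, f), (K, h)). embedding H G f \<and> embedding K G h \<and>
     (\<exists>z. graph_iso H K z \<and> f = comp_gmap H h z)}"

definition Emb :: "('e, 'v) dgraph \<Rightarrow> ('e, 'v) emb set set" where
  "Emb G = embeddings_into G // emb_rel G"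

definition emb_class :: "('e, 'v) dgraph \<Rightarrow> ('e, 'v) emb \<Rightarrow> ('e, 'v) emb set" where
  "emb_class G h = emb_rel G `` {h}"

definition emb_le :: "('e, 'v) emb set \<Rightarrow> ('e, 'v) emb set \<Rightarrow> bool" where
  "emb_le c d \<longleftrightarrow>
     (\<exists>H h K k j. (H, h) \<in> c \<and> (K, k) \<in> d \<and> embedding H K j \<and> h = comp_gmap H k j)"

definition is_edge :: "('e, 'v) emb set \<Rightarrow> bool" where
  "is_edge c \<longleftrightarrow> (\<exists>H f. (H, f) \<in> c \<and> verts H = {})"

text \<open>The following quantities do not depend on the representative of a class, so \<open>the_elem\<close>
  picks out their common value. The free commutative monoid on a set is modelled by
  multisets.\<close>

definition emb_verts :: "('e, 'v) emb set \<Rightarrow> 'v set" where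
  "emb_verts c = the_elem ((\<lambda>(H, f). snd f ` verts H) ` c)"

definition emb_edges :: "('e, 'v) emb set \<Rightarrow> 'e set" where
  "emb_edges c = the_elem ((\<lambda>(H, f). fst f ` edges H) ` c)"

definition emb_in :: "('e, 'v) emb set \<Rightarrow> 'e multiset" where
  "emb_in c = the_elem ((\<lambda>(H, f). \<Sum>e \<in> in_legs H. {#fst f e#}) ` c)"

definition emb_out :: "('e, 'v) emb set \<Rightarrow> 'e multiset" where
  "emb_out c = the_elem ((\<lambda>(H, f). \<Sum>e \<in> out_legs H. {#fst f e#}) ` c)"

definition is_union :: "('e, 'v) emb set \<Rightarrow> ('e, 'v) emb set \<Rightarrow> ('e, 'v) emb set \<Rightarrow> bool" where
  "is_union l h k \<longleftrightarrow> emb_le h l \<and> emb_le k l \<and> emb_verts l = emb_verts h \<union> emb_verts k"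

definition vertex_disjoint :: "('e, 'v) emb set \<Rightarrow> ('e, 'v) emb set \<Rightarrow> bool" where
  "vertex_disjoint h k \<longleftrightarrow> emb_verts h \<inter> emb_verts k = {}"

definition convex_inclusion :: "('e, 'v) dgraph \<Rightarrow> ('e, 'v) dgraph \<Rightarrow> ('e, 'v) gmap \<Rightarrow> bool" where
  "convex_inclusion H G f \<longleftrightarrow> embedding H G f \<and>
     inj_on (fst f) (edges H) \<and> inj_on (snd f) (verts H) \<and>
     (\<forall>es vs. directed_path G es vs \<and> hd es \<in> fst f ` edges H \<and> last es \<in> fst f ` edges H
        \<longrightarrow> set es \<subseteq> fst f ` edges H \<and> set vs \<subseteq> snd f ` verts H)"

definition sSb :: "('e, 'v) dgraph \<Rightarrow> ('e, 'v) emb set set" where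
  "sSb G = {emb_class G (H, f) | H f. convex_inclusion H G f}"

text \<open>Elements of \<open>sSb G\<close> are kept as classes; identifying them with their images, this says that
  \<open>l\<close> is the subgraph \<open>h \<union> k\<close>.\<close>

definition is_subgraph_union ::
  "('e, 'v) emb set \<Rightarrow> ('e, 'v) emb set \<Rightarrow> ('e, 'v) emb set \<Rightarrow> bool" where
  "is_subgraph_union l h k \<longleftrightarrow>
     emb_edges l = emb_edges h \<union> emb_edges k \<and> emb_verts l = emb_verts h \<union> emb_verts k"

text \<open>The inclusion of the subgraph at \<open>v\<close> represents the star embedding if \<open>v\<close> has no loops, as
  is the case in acyclic graphs. (At a loop, the domain of the star embedding would have two
  copies of that edge.)\<close>

definition star_graph :: "('e, 'v) dgraph \<Rightarrow> 'v \<Rightarrow> ('e, 'v) dgraph" where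
  "star_graph G v = \<lparr>edges = in_edges G v \<union> out_edges G v, inputs = in_edges G v, verts = {v},
     outputs = out_edges G v, tgt = (\<lambda>e \<in> in_edges G v. v), src = (\<lambda>e \<in> out_edges G v. v)\<rparr>"

definition star_class :: "('e, 'v) dgraph \<Rightarrow> 'v \<Rightarrow> ('e, 'v) emb set" where
  "star_class G v = emb_class G (star_graph G v,
     (\<lambda>e \<in> edges (star_graph G v). e), (\<lambda>w \<in> verts (star_graph G v). w))"


section \<open>The graphical categories and the comparison functor\<close>

type_synonym ('e, 'v) gmor = "('e \<Rightarrow> 'e) \<times> (('e, 'v) emb set \<Rightarrow> ('e, 'v) emb set)"

definition U_Hom :: "('e, 'v) dgraph \<Rightarrow> ('e, 'v) dgraph \<Rightarrow> ('e, 'v) gmor set" where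
  "U_Hom G G' = {(\<phi>0, \<phi>). \<phi>0 \<in> edges G \<rightarrow>\<^sub>E edges G' \<and> \<phi> \<in> Emb G \<rightarrow>\<^sub>E Emb G' \<and>
     (\<forall>h \<in> Emb G. is_edge h \<longrightarrow> is_edge (\<phi> h)) \<and>
     (\<forall>l \<in> Emb G. \<forall>h \<in> Emb G. \<forall>k \<in> Emb G. is_union l h k \<longrightarrow> is_union (\<phi> l) (\<phi> h) (\<phi> k)) \<and>
     (\<forall>h \<in> Emb G. \<forall>k \<in> Emb G. vertex_disjoint h k \<longrightarrow> vertex_disjoint (\<phi> h) (\<phi> k)) \<and>
     (\<forall>h \<in> Emb G. emb_in (\<phi> h) = image_mset \<phi>0 (emb_in h) \<and>
                  emb_out (\<phi> h) = image_mset \<phi>0 (emb_out h))}"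

definition U_cat :: "(('e, 'v) dgraph, ('e, 'v) gmor) cat" where
  "U_cat = \<lparr>Ob = {G. connected_graph G}, Hom = U_Hom,
     Comp = (\<lambda>G G' G'' \<psi> \<phi>. (compose (edges G) (fst \<psi>) (fst \<phi>), compose (Emb G) (snd \<psi>) (snd \<phi>))),
     Ident = (\<lambda>G. (\<lambda>e \<in> edges G. e, \<lambda>h \<in> Emb G. h))\<rparr>"

definition U0_cat :: "(('e, 'v) dgraph, ('e, 'v) gmor) cat" where
  "U0_cat = full_subcat U_cat directed_tree"

definition G_Hom :: "('e, 'v) dgraph \<Rightarrow> ('e, 'v) dgraph \<Rightarrow> ('e, 'v) gmor set" where
  "G_Hom G G' = {(\<phi>0, \<phi>). \<phi>0 \<in> edges G \<rightarrow>\<^sub>E edges G' \<and> \<phi> \<in> sSb G \<rightarrow>\<^sub>E sSb G' \<and>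
     (\<forall>h \<in> sSb G. emb_in (\<phi> h) = image_mset \<phi>0 (emb_in h) \<and>
                  emb_out (\<phi> h) = image_mset \<phi>0 (emb_out h)) \<and>
     (\<forall>h \<in> sSb G. \<forall>k \<in> sSb G. \<forall>l \<in> sSb G.
        is_subgraph_union l h k \<longrightarrow> is_subgraph_union (\<phi> l) (\<phi> h) (\<phi> k))}"

definition G_cat :: "(('e, 'v) dgraph, ('e, 'v) gmor) cat" where
  "G_cat = \<lparr>Ob = {G. acyclic_graph G}, Hom = G_Hom,
     Comp = (\<lambda>G G' G'' \<psi> \<phi>. (compose (edges G) (fst \<psi>) (fst \<phi>), compose (sSb G) (snd \<psi>) (snd \<phi>))),
     Ident = (\<lambda>G. (\<lambda>e \<in> edges G. e, \<lambda>h \<in> sSb G. h))\<rparr>"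

definition Gsc_cat :: "(('e, 'v) dgraph, ('e, 'v) gmor) cat" where
  "Gsc_cat = full_subcat G_cat directed_tree"

text \<open>As functors are only constrained on objects and morphisms of the given category, the
  restriction of this functor to a subcategory is given by the same data.\<close>

definition G_to_U ::
  "(('e, 'v) dgraph, ('e, 'v) gmor, ('e, 'v) dgraph, ('e, 'v) gmor) ftor" where
  "G_to_U = \<lparr>ob_map = (\<lambda>G. G),
     mor_map = (\<lambda>G G' \<phi>. THE \<psi>. \<psi> \<in> U_Hom G G' \<and> fst \<psi> = fst \<phi> \<and>
        (\<forall>v \<in> verts G. snd \<psi> (star_class G v) = snd \<phi> (star_class G v)))\<rparr>"

end

theory Submission
  imports Defs
begin

text \<open>Between directed trees the two kinds of morphisms are the same pairs of functions, so the functor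
  is the identity. Everything follows from the fact that each inner edge of a tree is a bridge.
  Cutting at bridges shows that every embedding into a tree is injective on edges and convex, so that
  \<open>Emb G = sSb G\<close> consists of the single edges and of the nonempty connected sets of vertices together
  with all their incident edges, and that the two notions of union coincide. A map that preserves
  inputs and outputs takes edges to edges, since a subtree whose only input leg is also its only output leg
  is an edge. It takes disjoint subtrees to disjoint ones, since these may be assumed to
  share a leg, and a bridge separates any two subtrees of which it is an output and an input leg.\<close>

section \<open>Connectedness and bridges\<close>

text \<open>Connectedness is given through decompositions of graphs, which are awkward to cut. It is
  therefore translated into \<open>vconnected\<close>, a condition on vertex sets. The only
  connected graphs left out are the single edges without vertices, which cause the case distinctions
  throughout. A bridge is recorded by one side of its cut, and the separation arguments substitute
  this side into \<open>vconnected\<close>. In general an embedding may glue an input leg of its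
  domain to an output leg, so a class need not be a subgraph. Once this is excluded over trees,
  \<open>embedding_factor\<close> turns the order on classes into containment of images, and legs
  and unions can be read off a pair of an edge set and a vertex set. The functor is defined by a
  description that fixes only the edge function and the values on stars. The given morphism fits it
  as soon as the morphism sets agree. It is the only one because preserved unions propagate the
  values from edges and stars to all subtrees.\<close>

definition inner_edges :: "('e, 'v) dgraph \<Rightarrow> 'e set" where
  "inner_edges G = inputs G \<inter> outputs G"

text \<open>An etale map is bijective on the edges at each vertex, so a subgraph with vertex set
  \<open>V\<close> has to contain all these edges; one with a single end in \<open>V\<close> becomes
  a leg.\<close>

definition incident :: "('e, 'v) dgraph \<Rightarrow> 'v set \<Rightarrow> 'e set" where
  "incident G V = {e \<in> inputs G. tgt G e \<in> V} \<union> {e \<in> outputs G. src G e \<in> V}"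

text \<open>The set \<open>A\<close> is not confined to \<open>V\<close>, so the side of a cut or
  the preimage of a vertex set can be substituted for it directly.\<close>

definition vconnected :: "('e, 'v) dgraph \<Rightarrow> 'v set \<Rightarrow> bool" where
  "vconnected G V \<longleftrightarrow> (\<forall>A. V \<inter> A \<noteq> {} \<and> V - A \<noteq> {} \<longrightarrow>
     (\<exists>e \<in> inner_edges G. src G e \<in> V \<and> tgt G e \<in> V \<and> (src G e \<in> A) \<noteq> (tgt G e \<in> A)))"

lemma vconnectedD:
  assumes "vconnected G V" "V \<inter> A \<noteq> {}" "V - A \<noteq> {}"
  obtains e where "e \<in> inner_edges G" "src G e \<in> V" "tgt G e \<in> V"
    "(src G e \<in> A) \<noteq> (tgt G e \<in> A)"
  using assms unfolding vconnected_def by meson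

lemma digraphD:
  assumes "digraph G"
  shows "finite (edges G)" "finite (verts G)" "inputs G \<subseteq> edges G" "outputs G \<subseteq> edges G"
    "\<And>e. e \<in> inputs G \<Longrightarrow> tgt G e \<in> verts G" "\<And>e. e \<in> outputs G \<Longrightarrow> src G e \<in> verts G"
  using assms unfolding digraph_def by (auto simp: PiE_iff)

text \<open>Otherwise the edge would split off as a component without vertices.\<close>

lemma connected_graph_isolated_edge:
  fixes G :: "('e, 'v) dgraph"
  assumes G: "connected_graph G" and e: "e \<in> edges G" "e \<notin> inputs G" "e \<notin> outputs G"
  shows "edges G = {e}" "verts G = {}"
proof -
  have dG: "digraph G" using G by (simp add: connected_graph_def)
  define A :: "('e, 'v) dgraph" where "A = \<lparr>edges = {e}, inputs = {}, verts = {}, outputs = {},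
    tgt = (\<lambda>_. undefined), src = (\<lambda>_. undefined)\<rparr> "
  define B where "B = \<lparr>edges = edges G - {e}, inputs = inputs G, verts = verts G,
    outputs = outputs G, tgt = tgt G, src = src G\<rparr>"
  have "digraph A" "digraph B"
    using dG e by (auto simp: digraph_def A_def B_def)
  moreover have "nonempty_graph A" by (simp add: A_def nonempty_graph_def)
  moreover have "disjoint_union_of G A B"
    using e by (auto simp: disjoint_union_of_def A_def B_def)
  ultimately have "\<not> nonempty_graph B" using G by (auto simp: connected_graph_def)
  then show "edges G = {e}" "verts G = {}" using e by (auto simp: nonempty_graph_def B_def)
qed

lemma connected_graph_imp_vconnected:
  assumes G: "connected_graph G"
  shows "vconnected G (verts G)"
proof (rule ccontr)
  assume "\<not> vconnected G (verts G)"
  then obtain S where S: "verts G \<inter> S \<noteq> {}" "verts G - S \<noteq> {}"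
    and nocross: "\<And>e. \<lbrakk>e \<in> inner_edges G; src G e \<in> verts G; tgt G e \<in> verts G\<rbrakk>
      \<Longrightarrow> (src G e \<in> S) = (tgt G e \<in> S)"
    unfolding vconnected_def by blast
  have dG: "digraph G" using G by (simp add: connected_graph_def)
  note d = digraphD[OF dG]
  define sub where "sub E V = \<lparr>edges = E, inputs = inputs G \<inter> E, verts = V,
    outputs = outputs G \<inter> E, tgt = restrict (tgt G) (inputs G \<inter> E),
    src = restrict (src G) (outputs G \<inter> E)\<rparr>" for E V
  \<comment> \<open>Edges with an end in \<open>S\<close> go to \<open>?A\<close>, all others to
    \<open>?B\<close>. As no inner edge crosses, both ends of an edge of \<open>?A\<close> lie in
    \<open>S\<close>.\<close>
  let ?A = "sub (incident G S) (verts G \<inter> S)"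
  let ?B = "sub (edges G - incident G S) (verts G - S)"
  have nc: "(src G e \<in> S) = (tgt G e \<in> S)" if "e \<in> inputs G" "e \<in> outputs G" for e
    using nocross[of e] that d by (auto simp: inner_edges_def)
  have fin: "finite (incident G S)"
    by (rule finite_subset[OF _ d(1)]) (use d in \<open>auto simp: incident_def\<close>)
  have "digraph ?A"
    using d fin nc by (auto simp: digraph_def sub_def incident_def)
  moreover have "digraph ?B"
    using d by (auto simp: digraph_def sub_def incident_def)
  moreover have "nonempty_graph ?A" "nonempty_graph ?B"
    using S by (auto simp: nonempty_graph_def sub_def)
  moreover have "disjoint_union_of G ?A ?B"
    using d by (auto simp: disjoint_union_of_def sub_def incident_def)
  ultimately show False using G unfolding connected_graph_def by blast
qed

text \<open>This dichotomy is the source of the two shapes in \<open>subtree\<close>: an edge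
  without ends can only be the whole graph.\<close>

lemma connected_graph_cases:
  assumes G: "connected_graph G"
  obtains (edge) e where "edges G = {e}" "verts G = {}" "inputs G = {}" "outputs G = {}"
  | (verts) "verts G \<noteq> {}" "vconnected G (verts G)" "edges G = inputs G \<union> outputs G"
proof -
  have dG: "digraph G" using G by (simp add: connected_graph_def)
  note d = digraphD[OF dG]
  show ?thesis
  proof (cases "verts G = {}")
    case True
    then have io: "inputs G = {}" "outputs G = {}" using d by auto
    obtain e where "e \<in> edges G"
      using G True by (auto simp: connected_graph_def nonempty_graph_def)
    then show ?thesis
      using connected_graph_isolated_edge[OF G] io True by (intro edge[of e]) auto
  next
    case False
    then show ?thesis
      using connected_graph_isolated_edge(2)[OF G] connected_graph_imp_vconnected[OF G] d
      by (intro verts) auto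
  qed
qed

lemma connected_graph_edgeI:
  fixes G :: "('e, 'v) dgraph"
  assumes "digraph G" "edges G = {e}" "verts G = {}"
  shows "connected_graph G"
proof -
  have "edges A = {} \<or> edges B = {}" if "{e} = edges A \<union> edges B" "edges A \<inter> edges B = {}" for A B :: "('e, 'v) dgraph"
    using that by (auto simp: singleton_Un_iff)
  then show ?thesis
    using assms by (auto simp: connected_graph_def nonempty_graph_def disjoint_union_of_def)
qed

text \<open>Since every edge has an end, both parts of a decomposition contain vertices. An inner
  edge that crosses between them would belong to both parts.\<close>

lemma connected_graph_vertsI:
  assumes G: "digraph G" and ne: "verts G \<noteq> {}" and conn: "vconnected G (verts G)"
    and E: "edges G = inputs G \<union> outputs G"
  shows "connected_graph G"
proof -
  have False if A: "digraph A" "nonempty_graph A" and B: "digraph B" "nonempty_graph B"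
    and U: "disjoint_union_of G A B" for A B
  proof -
    note dA = digraphD[OF A(1)] and dB = digraphD[OF B(1)]
    have U': "edges A \<inter> edges B = {}" "verts A \<inter> verts B = {}" "edges G = edges A \<union> edges B"
      "verts G = verts A \<union> verts B" "inputs G = inputs A \<union> inputs B"
      "outputs G = outputs A \<union> outputs B"
      "\<And>e. e \<in> inputs A \<Longrightarrow> tgt G e = tgt A e" "\<And>e. e \<in> inputs B \<Longrightarrow> tgt G e = tgt B e"
      "\<And>e. e \<in> outputs A \<Longrightarrow> src G e = src A e" "\<And>e. e \<in> outputs B \<Longrightarrow> src G e = src B e"
      using U unfolding disjoint_union_of_def by blast+
    have "verts A \<noteq> {}"
    proof
      assume "verts A = {}"
      then have "inputs A = {}" "outputs A = {}" "edges A \<noteq> {}"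
        using dA A(2) by (auto simp: nonempty_graph_def)
      then have "edges A \<subseteq> edges B" using E U'(3,5,6) dB(3,4) by auto
      then show False using U'(1) \<open>edges A \<noteq> {}\<close> by auto
    qed
    moreover have "verts B \<noteq> {}"
    proof
      assume "verts B = {}"
      then have "inputs B = {}" "outputs B = {}" "edges B \<noteq> {}"
        using dB B(2) by (auto simp: nonempty_graph_def)
      then have "edges B \<subseteq> edges A" using E U'(3,5,6) dA(3,4) by auto
      then show False using U'(1) \<open>edges B \<noteq> {}\<close> by auto
    qed
    ultimately have "verts G \<inter> verts A \<noteq> {}" "verts G - verts A \<noteq> {}"
      using U'(2,4) by auto
    then obtain e where e: "e \<in> inner_edges G" "(src G e \<in> verts A) \<noteq> (tgt G e \<in> verts A)"
      by (rule vconnectedD[OF conn])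
    then have "e \<in> inputs A \<or> e \<in> inputs B" "e \<in> outputs A \<or> e \<in> outputs B"
      using U'(5,6) by (auto simp: inner_edges_def)
    moreover have "tgt G e \<in> verts A" if "e \<in> inputs A" using that U'(7) dA(5) by metis
    moreover have "tgt G e \<in> verts B" if "e \<in> inputs B" using that U'(8) dB(5) by metis
    moreover have "src G e \<in> verts A" if "e \<in> outputs A" using that U'(9) dA(6) by metis
    moreover have "src G e \<in> verts B" if "e \<in> outputs B" using that U'(10) dB(6) by metis
    ultimately show False using e U'(1,2) dA(3,4) dB(3,4) by blast
  qed
  then show ?thesis
    using G ne by (auto simp: connected_graph_def nonempty_graph_def)
qed

text \<open>A witness that \<open>x\<close> is a bridge, \<open>A\<close> being the side of its
  source. Fixing the orientation is what prevents directed paths from coming back across the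
  cut.\<close>

definition edge_cut :: "('e, 'v) dgraph \<Rightarrow> 'e \<Rightarrow> 'v set \<Rightarrow> bool" where
  "edge_cut G x A \<longleftrightarrow> src G x \<in> A \<and> tgt G x \<notin> A \<and>
     (\<forall>y \<in> inner_edges G. y \<noteq> x \<longrightarrow> (src G y \<in> A) = (tgt G y \<in> A))"

section \<open>Inner edges of directed trees are bridges\<close>

lemma directed_treeD:
  assumes "directed_tree G"
  shows "connected_graph G" "digraph G"
  using assms by (simp_all add: directed_tree_def connected_graph_def)

text \<open>Paths grow at their end, in step with \<open>rtrancl_induct\<close>.\<close>

inductive simple_path :: "('v \<times> 'v) set \<Rightarrow> 'v \<Rightarrow> 'v list \<Rightarrow> bool" for r u where
  single: "simple_path r u [u]"
| snoc: "\<lbrakk>simple_path r u vs; (last vs, w) \<in> r; w \<notin> set vs\<rbrakk> \<Longrightarrow> simple_path r u (vs @ [w])"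

lemma simple_path_props:
  assumes "simple_path r u vs"
  shows "vs \<noteq> [] \<and> hd vs = u \<and> distinct vs \<and> (\<forall>i. Suc i < length vs \<longrightarrow> (vs ! i, vs ! Suc i) \<in> r)"
  using assms
proof induction
  case (snoc vs w)
  have "((vs @ [w]) ! i, (vs @ [w]) ! Suc i) \<in> r" if "Suc i < length (vs @ [w])" for i
  proof (cases "Suc i < length vs")
    case True
    then show ?thesis using snoc by (simp add: nth_append)
  next
    case False
    then have "Suc i = length vs" using that by simp
    moreover from this have "i = length vs - 1" by simp
    ultimately show ?thesis using snoc by (auto simp: nth_append last_conv_nth)
  qed
  then show ?case using snoc by auto
qed auto

text \<open>The path is cut off at \<open>w\<close>. This deals with a step that returns to a vertex
  already visited.\<close>

lemma simple_path_shorten: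
  assumes "simple_path r u vs" "w \<in> set vs"
  shows "\<exists>ws. simple_path r u ws \<and> last ws = w"
  using assms
proof induction
  case single
  then show ?case using simple_path.single by fastforce
next
  case (snoc vs w')
  then show ?case
    using simple_path.snoc[OF snoc.hyps] by (cases "w = w'") force+
qed

lemma rtrancl_imp_simple_path:
  assumes "(u, w) \<in> r\<^sup>*"
  shows "\<exists>vs. simple_path r u vs \<and> last vs = w"
  using assms
proof (induction rule: rtrancl_induct)
  case base
  then show ?case using simple_path.single by fastforce
next
  case (step y z)
  then obtain vs where vs: "simple_path r u vs" "last vs = y" by blast
  show ?case
  proof (cases "z \<in> set vs")
    case True
    then show ?thesis using simple_path_shorten[OF vs(1)] by blast
  next
    case False
    then have "simple_path r u (vs @ [z])" using vs step.hyps simple_path.snoc by metis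
    then show ?thesis by fastforce
  qed
qed

text \<open>Otherwise a simple path from the source to the target that avoids the edge would close up
  to a cycle.\<close>

lemma directed_tree_edge_cut:
  assumes G: "directed_tree G" and x: "x \<in> inner_edges G"
  obtains A where "edge_cut G x A"
proof -
  \<comment> \<open>Symmetric adjacency after deletion of \<open>x\<close>; \<open>A\<close> is then
    the component of the source of \<open>x\<close>.\<close>
  define r where "r = {(a, b). \<exists>y \<in> inner_edges G. y \<noteq> x \<and> {src G y, tgt G y} = {a, b}}"
  define A where "A = {w. (src G x, w) \<in> r\<^sup>*}"
  have "tgt G x \<notin> A"
  proof
    assume "tgt G x \<in> A"
    then obtain vs where "simple_path r (src G x) vs" and last: "last vs = tgt G x"
      using rtrancl_imp_simple_path[of "src G x" "tgt G x" r] by (auto simp: A_def)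
    then have vs: "vs \<noteq> []" "hd vs = src G x" "distinct vs"
      "\<And>i. Suc i < length vs \<Longrightarrow> (vs ! i, vs ! Suc i) \<in> r"
      using simple_path_props[of r "src G x" vs] by auto
    \<comment> \<open>\<open>n = 0\<close> is allowed: then \<open>x\<close> is a loop and the cycle
      has length 1.\<close>
    define n where "n = length vs - 1"
    have len: "length vs = Suc n" using vs(1) by (simp add: n_def)
    have "\<forall>i<n. \<exists>y. y \<in> inner_edges G \<and> y \<noteq> x \<and> {src G y, tgt G y} = {vs ! i, vs ! Suc i}"
      using vs(4) len unfolding r_def by auto
    then obtain y where y: "\<And>i. i < n \<Longrightarrow> y i \<in> inner_edges G" "\<And>i. i < n \<Longrightarrow> y i \<noteq> x"
      "\<And>i. i < n \<Longrightarrow> {src G (y i), tgt G (y i)} = {vs ! i, vs ! Suc i}"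
      by metis
    \<comment> \<open>On a path without repeated vertices, the pair of ends of a step determines its
      position, so no edge is used twice.\<close>
    have "i = j" if "i < n" "j < n" "y i = y j" for i j
    proof -
      have "{vs ! i, vs ! Suc i} = {vs ! j, vs ! Suc j}" using y(3) that by metis
      then show ?thesis
        using vs(3) that len by (auto simp: doubleton_eq_iff nth_eq_iff_index_eq)
    qed
    then have "inj_on y {..<n}" by (auto simp: inj_on_def)
    then have dist: "distinct (map y [0..<n] @ [x])"
      using y(2) by (auto simp: distinct_map atLeast0LessThan)
    have "undirected_cycle G vs (map y [0..<n] @ [x])"
      unfolding undirected_cycle_def
    proof (intro conjI allI impI)
      fix i assume i: "i < length (map y [0..<n] @ [x])"
      let ?e = "(map y [0..<n] @ [x]) ! i"
      have "?e \<in> inner_edges G \<and>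
        {src G ?e, tgt G ?e} = {vs ! i, vs ! (Suc i mod length (map y [0..<n] @ [x]))}"
      proof (cases "i < n")
        case True
        then show ?thesis using y by (simp add: nth_append)
      next
        \<comment> \<open>The closing edge \<open>x\<close> leads back to \<open>vs ! 0\<close>,
          because \<open>Suc n mod Suc n\<close> is 0.\<close>
        case False
        then have "i = n" using i by simp
        moreover have "vs ! n = tgt G x" "vs ! 0 = src G x"
          using vs(1,2) last by (simp_all add: n_def last_conv_nth hd_conv_nth)
        ultimately show ?thesis using x by (auto simp: nth_append)
      qed
      then show "?e \<in> inputs G \<inter> outputs G" "{src G ?e, tgt G ?e}
          = {vs ! i, vs ! (Suc i mod length (map y [0..<n] @ [x]))}"
        by (auto simp: inner_edges_def)
    qed (use len vs dist in auto)
    then show False using G by (auto simp: directed_tree_def)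
  qed
  moreover have "(src G y \<in> A) = (tgt G y \<in> A)" if "y \<in> inner_edges G" "y \<noteq> x" for y
  proof -
    have "(src G y, tgt G y) \<in> r" "(tgt G y, src G y) \<in> r" using that by (auto simp: r_def)
    then show ?thesis unfolding A_def by (auto intro: rtrancl_into_rtrancl)
  qed
  ultimately have "edge_cut G x A" by (auto simp: edge_cut_def A_def)
  then show thesis by (rule that)
qed

text \<open>If \<open>V\<close> also met the complement of \<open>A\<close>, an inner edge with both
  ends in \<open>V\<close> would cross the cut. Only \<open>x\<close> crosses, and its target is not
  in \<open>V\<close>.\<close>

lemma edge_cut_vconnected_source_side:
  assumes "edge_cut G x A" "vconnected G V" "src G x \<in> V" "tgt G x \<notin> V"
  shows "V \<subseteq> A"
proof (rule ccontr)
  assume "\<not> V \<subseteq> A"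
  moreover have "V \<inter> A \<noteq> {}" using assms by (auto simp: edge_cut_def)
  ultimately obtain e where "e \<in> inner_edges G" "tgt G e \<in> V" "(src G e \<in> A) \<noteq> (tgt G e \<in> A)"
    using vconnectedD[OF assms(2), of A] by blast
  then show False using assms by (auto simp: edge_cut_def)
qed

lemma edge_cut_vconnected_target_side:
  assumes "edge_cut G x A" "vconnected G V" "tgt G x \<in> V" "src G x \<notin> V"
  shows "V \<inter> A = {}"
proof (rule ccontr)
  assume "V \<inter> A \<noteq> {}"
  moreover have "V - A \<noteq> {}" using assms by (auto simp: edge_cut_def)
  ultimately obtain e where "e \<in> inner_edges G" "src G e \<in> V" "(src G e \<in> A) \<noteq> (tgt G e \<in> A)"
    using vconnectedD[OF assms(2), of A] by blast
  then show False using assms by (auto simp: edge_cut_def)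
qed

text \<open>The only inner edge across the cut leaves \<open>A\<close>, so a directed path that
  starts outside cannot enter.\<close>

lemma directed_path_edge_cut:
  assumes path: "directed_path G es vs" and cut: "edge_cut G x A"
    and vs: "vs \<noteq> []" "hd vs \<notin> A"
  shows "set vs \<inter> A = {}"
proof -
  have "i < length vs \<Longrightarrow> vs ! i \<notin> A" for i
  proof (induction i)
    case 0
    then show ?case using vs by (simp add: hd_conv_nth)
  next
    case (Suc i)
    let ?e = "es ! Suc i"
    have "?e \<in> inner_edges G" "src G ?e = vs ! i" "tgt G ?e = vs ! Suc i"
      using path Suc.prems
      by (auto simp: directed_path_def in_edges_def out_edges_def inner_edges_def)
    then show ?case using cut Suc by (auto simp: edge_cut_def)
  qed
  then show ?thesis by (auto simp: in_set_conv_nth)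
qed

lemma directed_pathD:
  assumes "directed_path G es vs" "vs \<noteq> []"
  shows "hd es \<in> inputs G" "tgt G (hd es) = hd vs" "last es \<in> outputs G" "src G (last es) = last vs"
proof -
  have len: "length es = Suc (length vs)" "es \<noteq> []"
    using assms by (auto simp: directed_path_def)
  have i: "es ! i \<in> in_edges G (vs ! i)" "es ! Suc i \<in> out_edges G (vs ! i)" if "i < length vs" for i
    using assms that by (auto simp: directed_path_def)
  show "hd es \<in> inputs G" "tgt G (hd es) = hd vs"
    using i(1)[of 0] assms(2) len by (auto simp: in_edges_def hd_conv_nth)
  show "last es \<in> outputs G" "src G (last es) = last vs"
    using i(2)[of "length vs - 1"] assms(2) len by (auto simp: out_edges_def last_conv_nth)
qed

text \<open>The common first and last edge of a closed path is inner. After it the path is on the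
  target side of its cut, but it would have to end at its source.\<close>

lemma directed_tree_imp_acyclic:
  assumes G: "directed_tree G"
  shows "acyclic_graph G"
proof -
  have False if path: "directed_path G es vs" and vs: "vs \<noteq> []" and loop: "hd es = last es" for es vs
  proof -
    note p = directed_pathD[OF path vs]
    obtain A where A: "edge_cut G (hd es) A"
      using directed_tree_edge_cut[OF G, of "hd es"] p loop by (auto simp: inner_edges_def)
    then have "set vs \<inter> A = {}"
      using directed_path_edge_cut[OF path A vs] p by (auto simp: edge_cut_def)
    moreover have "last vs \<in> A" using A p loop by (auto simp: edge_cut_def)
    ultimately show False using vs last_in_set[of vs] by blast
  qed
  then show ?thesis using directed_treeD[OF G] by (auto simp: acyclic_graph_def)
qed


section \<open>Subtrees and classes of embeddings\<close>

text \<open>These pairs are exactly the images of embeddings, by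
  \<open>embedding_image_subtree\<close> and \<open>subgraph_inclusion_embedding\<close>. Single
  edges are listed apart because an empty vertex set does not determine the edge.\<close>

definition subtree :: "('e, 'v) dgraph \<Rightarrow> 'e set \<Rightarrow> 'v set \<Rightarrow> bool" where
  "subtree G E V \<longleftrightarrow> V = {} \<and> (\<exists>e \<in> edges G. E = {e}) \<or>
     V \<noteq> {} \<and> V \<subseteq> verts G \<and> vconnected G V \<and> E = incident G V"

text \<open>The legs of the domain of an embedding, read off from its image;
  \<open>embedding_output_iff\<close> justifies this over a tree.\<close>

definition sub_in_legs :: "('e, 'v) dgraph \<Rightarrow> 'e set \<Rightarrow> 'v set \<Rightarrow> 'e set" where
  "sub_in_legs G E V = {e \<in> E. \<not> (e \<in> outputs G \<and> src G e \<in> V)}"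

definition sub_out_legs :: "('e, 'v) dgraph \<Rightarrow> 'e set \<Rightarrow> 'v set \<Rightarrow> 'e set" where
  "sub_out_legs G E V = {e \<in> E. \<not> (e \<in> inputs G \<and> tgt G e \<in> V)}"

lemma incident_mono: "V \<subseteq> W \<Longrightarrow> incident G V \<subseteq> incident G W"
  by (auto simp: incident_def)

lemma incident_Un: "incident G (V \<union> W) = incident G V \<union> incident G W"
  by (auto simp: incident_def)

lemma incident_subset_edges: "digraph G \<Longrightarrow> incident G V \<subseteq> edges G"
  by (auto simp: incident_def digraph_def)

lemma subtree_subset_edges: "digraph G \<Longrightarrow> subtree G E V \<Longrightarrow> E \<subseteq> edges G"
  using incident_subset_edges by (auto simp: subtree_def)

section \<open>Etale maps and embeddings into trees\<close>

lemma graph_mapD: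
  assumes "graph_map H G f"
  shows "\<And>e. e \<in> edges H \<Longrightarrow> fst f e \<in> edges G" "\<And>v. v \<in> verts H \<Longrightarrow> snd f v \<in> verts G"
    "\<And>e. e \<in> inputs H \<Longrightarrow> fst f e \<in> inputs G" "\<And>e. e \<in> outputs H \<Longrightarrow> fst f e \<in> outputs G"
    "\<And>e. e \<in> inputs H \<Longrightarrow> tgt G (fst f e) = snd f (tgt H e)"
    "\<And>e. e \<in> outputs H \<Longrightarrow> src G (fst f e) = snd f (src H e)"
  using assms unfolding graph_map_def by (auto simp: PiE_iff)

lemma etale_lift_input:
  assumes "etale H G f" "e \<in> inputs G" "v \<in> verts H" "tgt G e = snd f v"
  obtains e' where "e' \<in> inputs H" "fst f e' = e" "tgt H e' = v"
proof -
  have "(e, v) \<in> (\<lambda>e. (fst f e, tgt H e)) ` inputs H"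
    using assms bij_betw_imp_surj_on unfolding etale_def by blast
  then show ?thesis using that by auto
qed

lemma etale_lift_output:
  assumes "etale H G f" "e \<in> outputs G" "v \<in> verts H" "src G e = snd f v"
  obtains e' where "e' \<in> outputs H" "fst f e' = e" "src H e' = v"
proof -
  have "(e, v) \<in> (\<lambda>e. (fst f e, src H e)) ` outputs H"
    using assms bij_betw_imp_surj_on unfolding etale_def by blast
  then show ?thesis using that by auto
qed

text \<open>For a map that is injective on edges, the comparison maps to the fibre products are
  injective too, so it remains to lift edges.\<close>

lemma etaleI:
  assumes H: "digraph H" and f: "graph_map H G f" and inj: "inj_on (fst f) (edges H)"
    and lift: "\<And>e v. \<lbrakk>e \<in> inputs G; v \<in> verts H; tgt G e = snd f v\<rbrakk>
      \<Longrightarrow> \<exists>e' \<in> inputs H. fst f e' = e \<and> tgt H e' = v"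
      "\<And>e v. \<lbrakk>e \<in> outputs G; v \<in> verts H; src G e = snd f v\<rbrakk>
      \<Longrightarrow> \<exists>e' \<in> outputs H. fst f e' = e \<and> src H e' = v"
  shows "etale H G f"
proof -
  note d = digraphD[OF H] and m = graph_mapD[OF f]
  have "inj_on (\<lambda>e. (fst f e, tgt H e)) (inputs H)" "inj_on (\<lambda>e. (fst f e, src H e)) (outputs H)"
    using inj d(3,4) by (auto simp: inj_on_def)
  moreover have "(\<lambda>e. (fst f e, tgt H e)) ` inputs H
      = {(e, v). e \<in> inputs G \<and> v \<in> verts H \<and> tgt G e = snd f v}"
    using lift(1) d m by (force simp: image_iff)
  moreover have "(\<lambda>e. (fst f e, src H e)) ` outputs H
      = {(e, v). e \<in> outputs G \<and> v \<in> verts H \<and> src G e = snd f v}"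
    using lift(2) d m by (force simp: image_iff)
  ultimately show ?thesis using f by (simp add: etale_def bij_betw_def)
qed

lemma embeddingD:
  assumes "embedding H G f"
  shows "connected_graph H" "connected_graph G" "digraph H" "digraph G" "etale H G f"
    "graph_map H G f" "inj_on (snd f) (verts H)"
  using assms by (auto simp: embedding_def etale_def connected_graph_def)

text \<open>Equal images have equal targets, and \<open>snd f\<close> is injective on vertices, so
  both inputs have the same image under the injective comparison map to the pullback.\<close>

lemma embedding_inputs_eqI:
  assumes f: "embedding H G f" and e: "e \<in> inputs H" "e' \<in> inputs H" "fst f e = fst f e'"
  shows "e = e'"
proof -
  note m = graph_mapD[OF embeddingD(6)[OF f]] and d = digraphD[OF embeddingD(3)[OF f]]
  have "snd f (tgt H e) = snd f (tgt H e')" using m(5) e by metis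
  then have "tgt H e = tgt H e'" using embeddingD(7)[OF f] d(5) e by (auto dest: inj_onD)
  moreover have "inj_on (\<lambda>e. (fst f e, tgt H e)) (inputs H)"
    using embeddingD(5)[OF f] by (auto simp: etale_def bij_betw_def)
  ultimately show ?thesis using e by (auto dest: inj_onD)
qed

lemma embedding_outputs_eqI:
  assumes f: "embedding H G f" and e: "e \<in> outputs H" "e' \<in> outputs H" "fst f e = fst f e'"
  shows "e = e'"
proof -
  note m = graph_mapD[OF embeddingD(6)[OF f]] and d = digraphD[OF embeddingD(3)[OF f]]
  have "snd f (src H e) = snd f (src H e')" using m(6) e by metis
  then have "src H e = src H e'" using embeddingD(7)[OF f] d(6) e by (auto dest: inj_onD)
  moreover have "inj_on (\<lambda>e. (fst f e, src H e)) (outputs H)"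
    using embeddingD(5)[OF f] by (auto simp: etale_def bij_betw_def)
  ultimately show ?thesis using e by (auto dest: inj_onD)
qed

text \<open>If an input and an output of \<open>H\<close> had the same image, the cut at this image would pull back
  to a partition of the vertices of \<open>H\<close> that no inner edge crosses.\<close>

lemma embedding_not_glue:
  assumes G: "directed_tree G" and f: "embedding H G f"
    and a: "a \<in> inputs H" "a \<notin> outputs H" and b: "b \<in> outputs H" "fst f a = fst f b"
  shows False
proof -
  note m = graph_mapD[OF embeddingD(6)[OF f]] and d = digraphD[OF embeddingD(3)[OF f]]
  let ?x = "fst f a"
  have x: "?x \<in> inner_edges G" "tgt G ?x = snd f (tgt H a)" "src G ?x = snd f (src H b)"
    using m(3,5)[OF a(1)] m(4,6)[OF b(1)] b(2) by (simp_all add: inner_edges_def)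
  obtain A where A: "edge_cut G ?x A" using directed_tree_edge_cut[OF G x(1)] by blast
  let ?A = "{v. snd f v \<in> A}"
  have "verts H \<inter> ?A \<noteq> {}" "verts H - ?A \<noteq> {}"
    using A x d(5,6) a b by (auto simp: edge_cut_def)
  then obtain y where y: "y \<in> inner_edges H" "(src H y \<in> ?A) \<noteq> (tgt H y \<in> ?A)"
    by (rule vconnectedD[OF connected_graph_imp_vconnected[OF embeddingD(1)[OF f]]])
  have y': "y \<in> inputs H" "y \<in> outputs H" using y by (auto simp: inner_edges_def)
  have "fst f y \<in> inner_edges G" "(src G (fst f y) \<in> A) \<noteq> (tgt G (fst f y) \<in> A)"
    using y y' m by (auto simp: inner_edges_def)
  then have "fst f y = ?x" using A by (auto simp: edge_cut_def)
  \<comment> \<open>The image of the crossing edge \<open>y\<close> crosses \<open>A\<close> and is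
    thus \<open>?x\<close>. As an input, \<open>y\<close> must be \<open>a\<close>, but
    \<open>a\<close> is not inner.\<close>
  then have "y = a" using embedding_inputs_eqI[OF f] y' a by blast
  then show False using y' a by simp
qed

text \<open>Two inputs or two outputs are told apart by the pullback squares. What remains is an
  input glued to an output, which \<open>embedding_not_glue\<close> excludes.\<close>

lemma embedding_inj_on_edges:
  assumes G: "directed_tree G" and f: "embedding H G f"
  shows "inj_on (fst f) (edges H)"
proof (rule inj_onI)
  fix a b assume ab: "a \<in> edges H" "b \<in> edges H" "fst f a = fst f b"
  show "a = b"
  proof (cases rule: connected_graph_cases[OF embeddingD(1)[OF f]])
    case (1 e)
    then show ?thesis using ab by auto
  next
    case 2
    then have "a \<in> inputs H \<or> a \<in> outputs H" "b \<in> inputs H \<or> b \<in> outputs H" using ab by auto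
    then show ?thesis
      using embedding_inputs_eqI[OF f] embedding_outputs_eqI[OF f] embedding_not_glue[OF G f] ab
      by metis
  qed
qed

text \<open>The etale condition lifts the image of \<open>e\<close> to an input of \<open>H\<close>;
  by injectivity on edges this lift is \<open>e\<close> itself.\<close>

lemma embedding_input_iff:
  assumes G: "directed_tree G" and f: "embedding H G f" and e: "e \<in> edges H"
  shows "e \<in> inputs H \<longleftrightarrow> fst f e \<in> inputs G \<and> tgt G (fst f e) \<in> snd f ` verts H"
proof
  note m = graph_mapD[OF embeddingD(6)[OF f]] and d = digraphD[OF embeddingD(3)[OF f]]
  show "fst f e \<in> inputs G \<and> tgt G (fst f e) \<in> snd f ` verts H" if "e \<in> inputs H"
    using that m d by auto
  assume *: "fst f e \<in> inputs G \<and> tgt G (fst f e) \<in> snd f ` verts H"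
  then obtain v where "v \<in> verts H" "tgt G (fst f e) = snd f v" by blast
  then obtain e' where e': "e' \<in> inputs H" "fst f e' = fst f e"
    using * etale_lift_input[OF embeddingD(5)[OF f]] by metis
  then have "e' = e" using embedding_inj_on_edges[OF G f] d(3) e by (auto dest: inj_onD)
  then show "e \<in> inputs H" using e' by simp
qed

lemma embedding_output_iff:
  assumes G: "directed_tree G" and f: "embedding H G f" and e: "e \<in> edges H"
  shows "e \<in> outputs H \<longleftrightarrow> fst f e \<in> outputs G \<and> src G (fst f e) \<in> snd f ` verts H"
proof
  note m = graph_mapD[OF embeddingD(6)[OF f]] and d = digraphD[OF embeddingD(3)[OF f]]
  show "fst f e \<in> outputs G \<and> src G (fst f e) \<in> snd f ` verts H" if "e \<in> outputs H"
    using that m d by auto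
  assume *: "fst f e \<in> outputs G \<and> src G (fst f e) \<in> snd f ` verts H"
  then obtain v where "v \<in> verts H" "src G (fst f e) = snd f v" by blast
  then obtain e' where e': "e' \<in> outputs H" "fst f e' = fst f e"
    using * etale_lift_output[OF embeddingD(5)[OF f]] by metis
  then have "e' = e" using embedding_inj_on_edges[OF G f] d(4) e by (auto dest: inj_onD)
  then show "e \<in> outputs H" using e' by simp
qed

text \<open>Etale lifting puts every edge at an image vertex into the image. A partition of the
  image vertices pulls back to \<open>H\<close>, and the image of a crossing edge of
  \<open>H\<close> crosses again.\<close>

lemma embedding_image_subtree:
  assumes f: "embedding H G f"
  shows "subtree G (fst f ` edges H) (snd f ` verts H)"
proof (cases rule: connected_graph_cases[OF embeddingD(1)[OF f]])
  case (1 e)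
  then show ?thesis using graph_mapD(1)[OF embeddingD(6)[OF f]] by (auto simp: subtree_def)
next
  case 2
  note m = graph_mapD[OF embeddingD(6)[OF f]] and d = digraphD[OF embeddingD(3)[OF f]]
  have "fst f ` edges H \<subseteq> incident G (snd f ` verts H)"
    using 2(3) m d(5,6) by (auto simp: incident_def)
  moreover have "incident G (snd f ` verts H) \<subseteq> fst f ` edges H"
  proof
    fix e assume "e \<in> incident G (snd f ` verts H)"
    then consider v where "v \<in> verts H" "e \<in> inputs G" "tgt G e = snd f v"
      | v where "v \<in> verts H" "e \<in> outputs G" "src G e = snd f v"
      by (auto simp: incident_def)
    then show "e \<in> fst f ` edges H"
    proof cases
      case 1
      obtain e' where "e' \<in> inputs H" "fst f e' = e"
        by (rule etale_lift_input[OF embeddingD(5)[OF f] 1(2,1,3)])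
      then show ?thesis using d(3) by auto
    next
      case 2
      obtain e' where "e' \<in> outputs H" "fst f e' = e"
        by (rule etale_lift_output[OF embeddingD(5)[OF f] 2(2,1,3)])
      then show ?thesis using d(4) by auto
    qed
  qed
  moreover have "vconnected G (snd f ` verts H)"
    unfolding vconnected_def
  proof (intro allI impI)
    fix A assume A: "snd f ` verts H \<inter> A \<noteq> {} \<and> snd f ` verts H - A \<noteq> {}"
    let ?A = "{v. snd f v \<in> A}"
    have "verts H \<inter> ?A \<noteq> {}" "verts H - ?A \<noteq> {}" using A by auto
    then obtain y where y: "y \<in> inner_edges H" "(src H y \<in> ?A) \<noteq> (tgt H y \<in> ?A)"
      by (rule vconnectedD[OF 2(2)])
    have y': "y \<in> inputs H" "y \<in> outputs H" using y by (auto simp: inner_edges_def)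
    show "\<exists>e\<in>inner_edges G. src G e \<in> snd f ` verts H \<and> tgt G e \<in> snd f ` verts H \<and>
        (src G e \<in> A) \<noteq> (tgt G e \<in> A)"
      using y y' m d by (intro bexI[of _ "fst f y"]) (auto simp: inner_edges_def)
  qed
  ultimately show ?thesis using 2(1) m(2) by (auto simp: subtree_def)
qed

definition subgraph :: "('e, 'v) dgraph \<Rightarrow> 'e set \<Rightarrow> 'v set \<Rightarrow> ('e, 'v) dgraph" where
  "subgraph G E V = \<lparr>edges = E, inputs = {e \<in> inputs G. tgt G e \<in> V}, verts = V,
     outputs = {e \<in> outputs G. src G e \<in> V}, tgt = (\<lambda>e \<in> {e \<in> inputs G. tgt G e \<in> V}. tgt G e),
     src = (\<lambda>e \<in> {e \<in> outputs G. src G e \<in> V}. src G e)\<rparr>"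

text \<open>The converse of \<open>embedding_image_subtree\<close>. It turns connected vertex sets
  found by cutting or enlarging into elements of \<open>Emb G\<close>.\<close>

lemma subgraph_inclusion_embedding:
  assumes G: "connected_graph G" and S: "subtree G E V"
  shows "embedding (subgraph G E V) G (\<lambda>e \<in> E. e, \<lambda>v \<in> V. v)"
proof -
  let ?H = "subgraph G E V"
  have dG: "digraph G" using G by (simp add: connected_graph_def)
  note d = digraphD[OF dG]
  have EV: "E \<subseteq> edges G" "V \<subseteq> verts G" "incident G V \<subseteq> E"
    using S subtree_subset_edges[OF dG S] by (auto simp: subtree_def incident_def)
  then have fin: "finite E" "finite V" using d by (auto intro: finite_subset)
  have dH: "digraph ?H"
    using EV fin by (auto simp: digraph_def subgraph_def incident_def)
  have "connected_graph ?H"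
    using S unfolding subtree_def
  proof (elim disjE conjE bexE)
    fix e assume "V = {}" "E = {e}"
    then show ?thesis using connected_graph_edgeI[OF dH] by (simp add: subgraph_def)
  next
    assume *: "V \<noteq> {}" "vconnected G V" "E = incident G V"
    have "vconnected ?H V"
      unfolding vconnected_def
    proof (intro allI impI)
      fix A assume "V \<inter> A \<noteq> {} \<and> V - A \<noteq> {}"
      then obtain e where "e \<in> inner_edges G" "src G e \<in> V" "tgt G e \<in> V"
        "(src G e \<in> A) \<noteq> (tgt G e \<in> A)"
        using vconnectedD[OF *(2), of A] by blast
      then show "\<exists>e\<in>inner_edges ?H. src ?H e \<in> V \<and> tgt ?H e \<in> V \<and> (src ?H e \<in> A) \<noteq> (tgt ?H e \<in> A)"
        by (intro bexI[of _ e]) (auto simp: subgraph_def inner_edges_def)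
    qed
    then show ?thesis
      using * by (intro connected_graph_vertsI[OF dH]) (auto simp: subgraph_def incident_def)
  qed
  moreover have "etale ?H G (\<lambda>e \<in> E. e, \<lambda>v \<in> V. v)"
    using EV by (intro etaleI[OF dH])
      (auto simp: graph_map_def subgraph_def incident_def inj_on_def)
  ultimately show ?thesis
    using G by (auto simp: embedding_def subgraph_def inj_on_def)
qed

lemma inj_on_via:
  assumes "inj_on h A" "\<And>x. x \<in> A \<Longrightarrow> h x = k (j x)"
  shows "inj_on j A"
  using assms by (auto simp: inj_on_def)

text \<open>Injectivity of \<open>k\<close> forces \<open>j\<close> to be \<open>h\<close> followed
  by the inverse of \<open>k\<close>. It respects ends because \<open>embedding_input_iff\<close>
  and \<open>embedding_output_iff\<close> detect the ends in \<open>K\<close> from the image in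
  \<open>G\<close>; its lifts are those of \<open>h\<close>.\<close>

lemma embedding_factor:
  assumes G: "directed_tree G" and h: "embedding H G h" and k: "embedding K G k"
    and le: "fst h ` edges H \<subseteq> fst k ` edges K" "snd h ` verts H \<subseteq> snd k ` verts K"
  obtains j where "embedding H K j" "h = comp_gmap H k j"
proof -
  note dH = digraphD[OF embeddingD(3)[OF h]] and dK = digraphD[OF embeddingD(3)[OF k]]
  note mh = graph_mapD[OF embeddingD(6)[OF h]] and mk = graph_mapD[OF embeddingD(6)[OF k]]
  note injh = embedding_inj_on_edges[OF G h] embeddingD(7)[OF h]
  note injk = embedding_inj_on_edges[OF G k] embeddingD(7)[OF k]
  define j where "j = (\<lambda>e \<in> edges H. inv_into (edges K) (fst k) (fst h e),
    \<lambda>v \<in> verts H. inv_into (verts K) (snd k) (snd h v))"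
  have j: "fst j e \<in> edges K" "fst k (fst j e) = fst h e" if "e \<in> edges H" for e
  proof -
    have "fst h e \<in> fst k ` edges K" using le that by blast
    then show "fst j e \<in> edges K" "fst k (fst j e) = fst h e"
      using that by (auto simp: j_def inv_into_into f_inv_into_f)
  qed
  have jv: "snd j v \<in> verts K" "snd k (snd j v) = snd h v" if "v \<in> verts H" for v
  proof -
    have "snd h v \<in> snd k ` verts K" using le that by blast
    then show "snd j v \<in> verts K" "snd k (snd j v) = snd h v"
      using that by (auto simp: j_def inv_into_into f_inv_into_f)
  qed
  have ext: "fst j e = undefined" if "e \<notin> edges H" for e
    using that by (simp add: j_def)
  have extv: "snd j v = undefined" if "v \<notin> verts H" for v
    using that by (simp add: j_def)
  have inputs: "fst j e \<in> inputs K" "tgt K (fst j e) = snd j (tgt H e)" if "e \<in> inputs H" for e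
  proof -
    have e: "e \<in> edges H" "tgt H e \<in> verts H" using that dH by auto
    have hk: "fst k (fst j e) \<in> inputs G" "tgt G (fst k (fst j e)) = snd h (tgt H e)"
      using mh that j[OF e(1)] by auto
    then show i: "fst j e \<in> inputs K"
      using embedding_input_iff[OF G k j(1)[OF e(1)]] le(2) e by auto
    then have "snd k (tgt K (fst j e)) = snd k (snd j (tgt H e))"
      using mk(5) hk jv[OF e(2)] by metis
    then show "tgt K (fst j e) = snd j (tgt H e)"
      by (rule inj_onD[OF injk(2) _ dK(5)[OF i] jv(1)[OF e(2)]])
  qed
  have outputs: "fst j e \<in> outputs K" "src K (fst j e) = snd j (src H e)" if "e \<in> outputs H" for e
  proof -
    have e: "e \<in> edges H" "src H e \<in> verts H" using that dH by auto
    have hk: "fst k (fst j e) \<in> outputs G" "src G (fst k (fst j e)) = snd h (src H e)"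
      using mh that j[OF e(1)] by auto
    then show i: "fst j e \<in> outputs K"
      using embedding_output_iff[OF G k j(1)[OF e(1)]] le(2) e by auto
    then have "snd k (src K (fst j e)) = snd k (snd j (src H e))"
      using mk(6) hk jv[OF e(2)] by metis
    then show "src K (fst j e) = snd j (src H e)"
      by (rule inj_onD[OF injk(2) _ dK(6)[OF i] jv(1)[OF e(2)]])
  qed
  have map: "graph_map H K j"
    using j(1) jv(1) inputs outputs ext extv unfolding graph_map_def
    by (auto simp: PiE_iff extensional_def)
  have inj: "inj_on (fst j) (edges H)" "inj_on (snd j) (verts H)"
    using inj_on_via[of "fst h" "edges H" "fst k" "fst j"]
      inj_on_via[of "snd h" "verts H" "snd k" "snd j"] injh j(2) jv(2) by simp_all
  have "etale H K j"
  proof (rule etaleI[OF embeddingD(3)[OF h] map inj(1)])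
    fix e v assume e: "e \<in> inputs K" "v \<in> verts H" "tgt K e = snd j v"
    then have "fst k e \<in> inputs G" "tgt G (fst k e) = snd h v" using mk jv by auto
    then obtain e' where e': "e' \<in> inputs H" "fst h e' = fst k e" "tgt H e' = v"
      using etale_lift_input[OF embeddingD(5)[OF h] _ e(2)] by blast
    then have E: "e' \<in> edges H" "e \<in> edges K" using dH(3) dK(3) e(1) by auto
    then have "fst k (fst j e') = fst k e" using j(2) e'(2) by simp
    then have "fst j e' = e" by (rule inj_onD[OF injk(1) _ j(1)[OF E(1)] E(2)])
    then show "\<exists>e' \<in> inputs H. fst j e' = e \<and> tgt H e' = v" using e' by blast
  next
    fix e v assume e: "e \<in> outputs K" "v \<in> verts H" "src K e = snd j v"
    then have "fst k e \<in> outputs G" "src G (fst k e) = snd h v" using mk jv by auto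
    then obtain e' where e': "e' \<in> outputs H" "fst h e' = fst k e" "src H e' = v"
      using etale_lift_output[OF embeddingD(5)[OF h] _ e(2)] by blast
    then have E: "e' \<in> edges H" "e \<in> edges K" using dH(4) dK(4) e(1) by auto
    then have "fst k (fst j e') = fst k e" using j(2) e'(2) by simp
    then have "fst j e' = e" by (rule inj_onD[OF injk(1) _ j(1)[OF E(1)] E(2)])
    then show "\<exists>e' \<in> outputs H. fst j e' = e \<and> src H e' = v" using e' by blast
  qed
  then have "embedding H K j" using h k inj by (simp add: embedding_def)
  moreover have "h = comp_gmap H k j"
  proof (rule prod_eqI)
    have "fst h \<in> extensional (edges H)" "snd h \<in> extensional (verts H)"
      using embeddingD(6)[OF h] by (simp_all add: graph_map_def PiE_iff)
    then show "fst h = fst (comp_gmap H k j)" "snd h = snd (comp_gmap H k j)"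
      using j(2) jv(2) unfolding comp_gmap_def
      by (auto intro: extensionalityI[OF _ compose_extensional] simp: compose_eq)
  qed
  ultimately show thesis by (rule that)
qed

section \<open>Classes of embeddings described by their images\<close>

lemma comp_gmap_image:
  "fst (comp_gmap H k j) ` edges H = fst k ` fst j ` edges H"
    "snd (comp_gmap H k j) ` verts H = snd k ` snd j ` verts H"
  by (auto simp: comp_gmap_def compose_def image_iff)

text \<open>Equal images give a factorisation \<open>j\<close>. It is onto edges and vertices since
  \<open>k\<close> is injective, and etale lifting makes it onto inputs and outputs, so it is an
  isomorphism.\<close>

lemma emb_rel_iff:
  assumes G: "directed_tree G"
  shows "((H, h), (K, k)) \<in> emb_rel G \<longleftrightarrow> embedding H G h \<and> embedding K G k \<and>
    fst h ` edges H = fst k ` edges K \<and> snd h ` verts H = snd k ` verts K"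
proof (intro iffI conjI)
  assume "((H, h), (K, k)) \<in> emb_rel G"
  then obtain z where hk: "embedding H G h" "embedding K G k" and z: "graph_iso H K z"
    and h: "h = comp_gmap H k z"
    unfolding emb_rel_def by blast
  show "embedding H G h" "embedding K G k" by fact+
  show "fst h ` edges H = fst k ` edges K" "snd h ` verts H = snd k ` verts K"
    using z comp_gmap_image[of H k z] unfolding h graph_iso_def bij_betw_def by simp_all
next
  assume *: "embedding H G h \<and> embedding K G k \<and>
    fst h ` edges H = fst k ` edges K \<and> snd h ` verts H = snd k ` verts K"
  then have h: "embedding H G h" and k: "embedding K G k" by blast+
  have "fst h ` edges H \<subseteq> fst k ` edges K" "snd h ` verts H \<subseteq> snd k ` verts K"
    using * by simp_all
  then obtain j where j: "embedding H K j" "h = comp_gmap H k j"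
    by (rule embedding_factor[OF G h k])
  note m = graph_mapD[OF embeddingD(6)[OF j(1)]]
  note dH = digraphD[OF embeddingD(3)[OF h]] and dK = digraphD[OF embeddingD(3)[OF k]]
  have fst_h: "fst h e = fst k (fst j e)" if "e \<in> edges H" for e
    using that by (simp add: j(2) comp_gmap_def compose_eq)
  have snd_h: "snd h v = snd k (snd j v)" if "v \<in> verts H" for v
    using that by (simp add: j(2) comp_gmap_def compose_eq)
  have inj: "inj_on (fst j) (edges H)"
    using inj_on_via[of "fst h" "edges H" "fst k" "fst j"] embedding_inj_on_edges[OF G h] fst_h
    by simp
  have "fst k ` fst j ` edges H = fst k ` edges K" "snd k ` snd j ` verts H = snd k ` verts K"
    using * comp_gmap_image[of H k j] j(2) by simp_all
  moreover have "fst j ` edges H \<subseteq> edges K" "snd j ` verts H \<subseteq> verts K" using m by auto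
  ultimately have surj: "fst j ` edges H = edges K" "snd j ` verts H = verts K"
    using inj_on_image_eq_iff[OF embedding_inj_on_edges[OF G k]]
      inj_on_image_eq_iff[OF embeddingD(7)[OF k]] by simp_all
  have "fst j ` inputs H = inputs K"
  proof
    show "fst j ` inputs H \<subseteq> inputs K" using m by auto
    show "inputs K \<subseteq> fst j ` inputs H"
    proof
      fix e assume e: "e \<in> inputs K"
      then obtain v where "v \<in> verts H" "tgt K e = snd j v" using surj(2) dK(5) by blast
      then show "e \<in> fst j ` inputs H"
        using etale_lift_input[OF embeddingD(5)[OF j(1)] e] by (metis image_eqI)
    qed
  qed
  moreover have "fst j ` outputs H = outputs K"
  proof
    show "fst j ` outputs H \<subseteq> outputs K" using m by auto
    show "outputs K \<subseteq> fst j ` outputs H"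
    proof
      fix e assume e: "e \<in> outputs K"
      then obtain v where "v \<in> verts H" "src K e = snd j v" using surj(2) dK(6) by blast
      then show "e \<in> fst j ` outputs H"
        using etale_lift_output[OF embeddingD(5)[OF j(1)] e] by (metis image_eqI)
    qed
  qed
  moreover have "inj_on (fst j) (inputs H)" "inj_on (fst j) (outputs H)"
    using inj dH(3,4) inj_on_subset by blast+
  ultimately have "graph_iso H K j"
    using surj inj embeddingD(6,7)[OF j(1)] by (simp add: graph_iso_def bij_betw_def)
  then show "((H, h), (K, k)) \<in> emb_rel G" using h k j(2) unfolding emb_rel_def by blast
qed


lemma emb_class_eq:
  assumes "directed_tree G" "embedding H G h"
  shows "emb_class G (H, h) = {(K, k). embedding K G k \<and>
    fst h ` edges H = fst k ` edges K \<and> snd h ` verts H = snd k ` verts K}"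
proof -
  have "((H, h), x) \<in> emb_rel G \<longleftrightarrow> x \<in> {(K, k). embedding K G k \<and>
    fst h ` edges H = fst k ` edges K \<and> snd h ` verts H = snd k ` verts K}" for x
    by (cases x) (simp only: emb_rel_iff[OF assms(1)] assms(2) mem_Collect_eq prod.case simp_thms)
  then show ?thesis by (auto simp only: emb_class_def Image_singleton mem_Collect_eq)
qed

lemma the_elem_image_const:
  assumes "x \<in> A" "\<And>y. y \<in> A \<Longrightarrow> f y = f x"
  shows "the_elem (f ` A) = f x"
proof -
  have "f ` A = (\<lambda>_. f x) ` A" by (rule image_cong[OF refl assms(2)])
  also have "\<dots> = {f x}" using assms(1) by auto
  finally show ?thesis by simp
qed

lemma emb_class_image:
  assumes "directed_tree G" "embedding H G h"
  shows "emb_edges (emb_class G (H, h)) = fst h ` edges H"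
    "emb_verts (emb_class G (H, h)) = snd h ` verts H"
proof -
  have mem: "(H, h) \<in> emb_class G (H, h)" using assms by (simp add: emb_class_eq)
  show "emb_edges (emb_class G (H, h)) = fst h ` edges H"
    unfolding emb_edges_def by (subst the_elem_image_const[OF mem]) (auto simp: emb_class_eq[OF assms])
  show "emb_verts (emb_class G (H, h)) = snd h ` verts H"
    unfolding emb_verts_def by (subst the_elem_image_const[OF mem]) (auto simp: emb_class_eq[OF assms])
qed

text \<open>By injectivity on edges no leg is counted twice, so the multiset of legs is the multiset
  of a set.\<close>

lemma embedding_leg_sums:
  assumes G: "directed_tree G" and h: "embedding H G h"
  shows "(\<Sum>e \<in> in_legs H. {#fst h e#}) = mset_set (sub_in_legs G (fst h ` edges H) (snd h ` verts H))"
    "(\<Sum>e \<in> out_legs H. {#fst h e#}) = mset_set (sub_out_legs G (fst h ` edges H) (snd h ` verts H))"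
proof -
  note inj = embedding_inj_on_edges[OF G h]
  have sum: "(\<Sum>e \<in> A. {#fst h e#}) = mset_set (fst h ` A)" if "A \<subseteq> edges H" for A
    using that inj_on_subset[OF inj that]
    by (simp add: sum_unfold_sum_mset image_mset_mset_set[symmetric])
  have "fst h ` in_legs H = sub_in_legs G (fst h ` edges H) (snd h ` verts H)"
    using embedding_output_iff[OF G h] by (auto simp: in_legs_def sub_in_legs_def)
  then show "(\<Sum>e \<in> in_legs H. {#fst h e#})
      = mset_set (sub_in_legs G (fst h ` edges H) (snd h ` verts H))"
    using sum[of "in_legs H"] by (simp add: in_legs_def)
  have "fst h ` out_legs H = sub_out_legs G (fst h ` edges H) (snd h ` verts H)"
    using embedding_input_iff[OF G h] by (auto simp: out_legs_def sub_out_legs_def)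
  then show "(\<Sum>e \<in> out_legs H. {#fst h e#})
      = mset_set (sub_out_legs G (fst h ` edges H) (snd h ` verts H))"
    using sum[of "out_legs H"] by (simp add: out_legs_def)
qed

lemma Emb_cases:
  assumes "c \<in> Emb G"
  obtains H h where "embedding H G h" "c = emb_class G (H, h)"
  using assms by (auto simp: Emb_def quotient_def embeddings_into_def emb_class_def)

lemma emb_class_in_Emb: "embedding H G h \<Longrightarrow> emb_class G (H, h) \<in> Emb G"
  using quotientI[of "(H, h)" "embeddings_into G" "emb_rel G"]
  by (simp add: Emb_def embeddings_into_def emb_class_def)

lemma Emb_subtree:
  assumes G: "directed_tree G" and c: "c \<in> Emb G"
  shows "subtree G (emb_edges c) (emb_verts c)"
proof -
  obtain H h where h: "embedding H G h" "c = emb_class G (H, h)" using c by (rule Emb_cases)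
  then show ?thesis using embedding_image_subtree emb_class_image[OF G h(1)] by simp
qed

lemma Emb_eqI:
  assumes G: "directed_tree G" and c: "c \<in> Emb G" and d: "d \<in> Emb G"
    and eq: "emb_edges c = emb_edges d" "emb_verts c = emb_verts d"
  shows "c = d"
proof -
  obtain H h where h: "embedding H G h" "c = emb_class G (H, h)" using c by (rule Emb_cases)
  obtain K k where k: "embedding K G k" "d = emb_class G (K, k)" using d by (rule Emb_cases)
  show ?thesis
    using eq emb_class_image[OF G h(1)] emb_class_image[OF G k(1)]
    unfolding h(2) k(2) emb_class_eq[OF G h(1)] emb_class_eq[OF G k(1)] by simp
qed

lemma subtree_class:
  assumes G: "directed_tree G" and S: "subtree G E V"
  shows "emb_class G (subgraph G E V, \<lambda>e \<in> E. e, \<lambda>v \<in> V. v) \<in> Emb G"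
    "emb_edges (emb_class G (subgraph G E V, \<lambda>e \<in> E. e, \<lambda>v \<in> V. v)) = E"
    "emb_verts (emb_class G (subgraph G E V, \<lambda>e \<in> E. e, \<lambda>v \<in> V. v)) = V"
proof -
  note i = subgraph_inclusion_embedding[OF directed_treeD(1)[OF G] S]
  show "emb_class G (subgraph G E V, \<lambda>e \<in> E. e, \<lambda>v \<in> V. v) \<in> Emb G"
    by (rule emb_class_in_Emb[OF i])
  show "emb_edges (emb_class G (subgraph G E V, \<lambda>e \<in> E. e, \<lambda>v \<in> V. v)) = E"
    "emb_verts (emb_class G (subgraph G E V, \<lambda>e \<in> E. e, \<lambda>v \<in> V. v)) = V"
    unfolding emb_class_image[OF G i] by (simp_all add: subgraph_def)
qed

lemma subtree_classE:
  assumes "directed_tree G" "subtree G E V"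
  obtains c where "c \<in> Emb G" "emb_edges c = E" "emb_verts c = V"
  using subtree_class[OF assms] by blast

lemma Emb_memberD:
  assumes G: "directed_tree G" and c: "c \<in> Emb G" and k: "(K, k) \<in> c"
  shows "embedding K G k" "fst k ` edges K = emb_edges c" "snd k ` verts K = emb_verts c"
proof -
  obtain H h where h: "embedding H G h" "c = emb_class G (H, h)" using c by (rule Emb_cases)
  have "embedding K G k \<and> fst h ` edges H = fst k ` edges K \<and> snd h ` verts H = snd k ` verts K"
    using k unfolding h(2) emb_class_eq[OF G h(1)] by simp
  then show "embedding K G k" "fst k ` edges K = emb_edges c" "snd k ` verts K = emb_verts c"
    using emb_class_image[OF G h(1)] by (simp_all add: h(2))
qed

lemma Emb_memberE:
  assumes "directed_tree G" "c \<in> Emb G"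
  obtains H h where "(H, h) \<in> c"
proof -
  obtain H h where "embedding H G h" "c = emb_class G (H, h)" using assms(2) by (rule Emb_cases)
  then show ?thesis using that assms(1) by (simp add: emb_class_eq)
qed

lemma emb_legs:
  assumes G: "directed_tree G" and c: "c \<in> Emb G"
  shows "emb_in c = mset_set (sub_in_legs G (emb_edges c) (emb_verts c))"
    "emb_out c = mset_set (sub_out_legs G (emb_edges c) (emb_verts c))"
proof -
  obtain H h where mem: "(H, h) \<in> c" using Emb_memberE[OF G c] .
  have sums: "(case x of (H, h) \<Rightarrow> \<Sum>e \<in> in_legs H. {#fst h e#})
      = mset_set (sub_in_legs G (emb_edges c) (emb_verts c))"
    "(case x of (H, h) \<Rightarrow> \<Sum>e \<in> out_legs H. {#fst h e#})
      = mset_set (sub_out_legs G (emb_edges c) (emb_verts c))"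
    if x: "x \<in> c" for x
  proof -
    obtain K k where xk: "x = (K, k)" by (cases x)
    note m = Emb_memberD[OF G c x[unfolded xk]]
    show "(case x of (H, h) \<Rightarrow> \<Sum>e \<in> in_legs H. {#fst h e#})
        = mset_set (sub_in_legs G (emb_edges c) (emb_verts c))"
      "(case x of (H, h) \<Rightarrow> \<Sum>e \<in> out_legs H. {#fst h e#})
        = mset_set (sub_out_legs G (emb_edges c) (emb_verts c))"
      using embedding_leg_sums[OF G m(1)] by (simp_all add: xk m)
  qed
  show "emb_in c = mset_set (sub_in_legs G (emb_edges c) (emb_verts c))"
    unfolding emb_in_def
    by (subst the_elem_image_const[OF mem]) (simp_all only: sums(1) sums(1)[OF mem])
  show "emb_out c = mset_set (sub_out_legs G (emb_edges c) (emb_verts c))"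
    unfolding emb_out_def
    by (subst the_elem_image_const[OF mem]) (simp_all only: sums(2) sums(2)[OF mem])
qed

lemma emb_le_iff:
  assumes G: "directed_tree G" and c: "c \<in> Emb G" and d: "d \<in> Emb G"
  shows "emb_le c d \<longleftrightarrow> emb_edges c \<subseteq> emb_edges d \<and> emb_verts c \<subseteq> emb_verts d"
proof
  assume "emb_le c d"
  then obtain H h K k j where hk: "(H, h) \<in> c" "(K, k) \<in> d" and j: "embedding H K j"
    "h = comp_gmap H k j"
    unfolding emb_le_def by blast
  have "fst j ` edges H \<subseteq> edges K" "snd j ` verts H \<subseteq> verts K"
    using graph_mapD(1,2)[OF embeddingD(6)[OF j(1)]] by auto
  then have "fst h ` edges H \<subseteq> fst k ` edges K" "snd h ` verts H \<subseteq> snd k ` verts K"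
    unfolding j(2) comp_gmap_image by auto
  then show "emb_edges c \<subseteq> emb_edges d \<and> emb_verts c \<subseteq> emb_verts d"
    using Emb_memberD[OF G c hk(1)] Emb_memberD[OF G d hk(2)] by simp
next
  assume le: "emb_edges c \<subseteq> emb_edges d \<and> emb_verts c \<subseteq> emb_verts d"
  obtain H h where h: "(H, h) \<in> c" using Emb_memberE[OF G c] .
  obtain K k where k: "(K, k) \<in> d" using Emb_memberE[OF G d] .
  note mh = Emb_memberD[OF G c h] and mk = Emb_memberD[OF G d k]
  have "fst h ` edges H \<subseteq> fst k ` edges K" "snd h ` verts H \<subseteq> snd k ` verts K"
    using le by (simp_all add: mh mk)
  then obtain j where "embedding H K j" "h = comp_gmap H k j"
    by (rule embedding_factor[OF G mh(1) mk(1)])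
  then show "emb_le c d" using h k unfolding emb_le_def by blast
qed

lemma is_edge_iff:
  assumes G: "directed_tree G" and c: "c \<in> Emb G"
  shows "is_edge c \<longleftrightarrow> emb_verts c = {}"
proof -
  obtain H h where "(H, h) \<in> c" using Emb_memberE[OF G c] .
  moreover have "verts K = {} \<longleftrightarrow> emb_verts c = {}" if "(K, k) \<in> c" for K k
    using Emb_memberD(3)[OF G c that] by auto
  ultimately show ?thesis unfolding is_edge_def by blast
qed

text \<open>Only the edges need an argument. If \<open>l\<close> has vertices, each of its edges
  meets a vertex of \<open>h\<close> or \<open>k\<close> and already lies there; otherwise all three
  classes are the same edge.\<close>

lemma is_union_iff:
  assumes G: "directed_tree G" and l: "l \<in> Emb G" and h: "h \<in> Emb G" and k: "k \<in> Emb G"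
  shows "is_union l h k \<longleftrightarrow> is_subgraph_union l h k"
proof -
  have "emb_edges l = emb_edges h \<union> emb_edges k"
    if "emb_edges h \<subseteq> emb_edges l" "emb_edges k \<subseteq> emb_edges l"
      "emb_verts l = emb_verts h \<union> emb_verts k"
  proof (cases "emb_verts l = {}")
    case True
    then show ?thesis
      using that Emb_subtree[OF G l] Emb_subtree[OF G h] Emb_subtree[OF G k]
      by (auto simp: subtree_def)
  next
    case False
    have "incident G (emb_verts h) \<subseteq> emb_edges h" "incident G (emb_verts k) \<subseteq> emb_edges k"
      using Emb_subtree[OF G h] Emb_subtree[OF G k] by (auto simp: subtree_def incident_def)
    moreover have "emb_edges l = incident G (emb_verts h) \<union> incident G (emb_verts k)"
      using Emb_subtree[OF G l] False that by (auto simp: subtree_def incident_Un)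
    ultimately show ?thesis using that by blast
  qed
  then show ?thesis
    unfolding is_union_def is_subgraph_union_def emb_le_iff[OF G h l] emb_le_iff[OF G k l] by auto
qed

section \<open>Stars, and convexity of subtrees\<close>

lemma star_class_eq:
  "star_class G v = emb_class G (subgraph G (incident G {v}) {v},
    \<lambda>e \<in> incident G {v}. e, \<lambda>w \<in> {v}. w)"
proof -
  have "star_graph G v = subgraph G (incident G {v}) {v}"
    by (auto simp: star_graph_def subgraph_def incident_def in_edges_def out_edges_def restrict_def)
  then show ?thesis by (simp add: star_class_def subgraph_def)
qed

lemma subtree_vertex: "v \<in> verts G \<Longrightarrow> subtree G (incident G {v}) {v}"
  by (auto simp: subtree_def vconnected_def)

text \<open>A path that leaves the subtree at its first vertex crosses the cut at its first edge and
  cannot come back.\<close>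

lemma directed_path_in_subtree:
  assumes G: "directed_tree G" and S: "subtree G E V"
  shows "\<lbrakk>directed_path G es vs; hd es \<in> E; last es \<in> E\<rbrakk> \<Longrightarrow> set es \<subseteq> E \<and> set vs \<subseteq> V"
proof (induction vs arbitrary: es)
  case Nil
  then show ?case by (auto simp: directed_path_def length_Suc_conv)
next
  case (Cons v vs)
  note path = directed_pathD[OF Cons.prems(1), simplified]
  obtain e es' where es: "es = e # es'" "length es' = Suc (length vs)"
    using Cons.prems(1) by (auto simp: directed_path_def length_Suc_conv)
  have path': "directed_path G es' vs"
    using Cons.prems(1) unfolding directed_path_def es by (auto dest: spec[of _ "Suc _"])
  have e: "e \<in> inputs G" "tgt G e = v" "e \<in> E" using path Cons.prems(2) es by auto
  have last: "last es \<in> outputs G" "src G (last es) = last (v # vs)" using path by auto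
  \<comment> \<open>If the subtree were a single edge, the path would be closed.\<close>
  have V: "V \<noteq> {}"
  proof
    assume "V = {}"
    then have "hd es = last es" using S Cons.prems(2,3) by (auto simp: subtree_def)
    then show False
      using directed_tree_imp_acyclic[OF G] Cons.prems(1) unfolding acyclic_graph_def by blast
  qed
  then have S': "vconnected G V" "E = incident G V" using S by (auto simp: subtree_def)
  have "v \<in> V"
  proof (rule ccontr)
    assume "v \<notin> V"
    then have x: "e \<in> inner_edges G" "src G e \<in> V"
      using e S' by (auto simp: incident_def inner_edges_def)
    obtain A where A: "edge_cut G e A" using directed_tree_edge_cut[OF G x(1)] by blast
    have VA: "V \<subseteq> A"
      using edge_cut_vconnected_source_side[OF A S'(1) x(2)] e \<open>v \<notin> V\<close> by simp
    have "v \<notin> A" using A e by (auto simp: edge_cut_def)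
    then have "set (v # vs) \<inter> A = {}"
      using directed_path_edge_cut[OF Cons.prems(1) A] by simp
    moreover have "last (v # vs) \<in> set (v # vs)" by (rule last_in_set) simp
    \<comment> \<open>The source of the last edge is off \<open>A\<close>, so this edge can only
      belong to \<open>E\<close> through its target. It would then be a second inner edge across the
      cut, in the opposite direction.\<close>
    ultimately have nA: "src G (last es) \<notin> A" using last by auto
    then have y: "last es \<in> inputs G" "tgt G (last es) \<in> V"
      using Cons.prems(3) S'(2) VA by (auto simp: incident_def)
    then have "last es \<in> inner_edges G" using last by (simp add: inner_edges_def)
    then show False using A nA y VA x by (auto simp: edge_cut_def)
  qed
  moreover have "hd es' \<in> E"
  proof -
    have "es ! Suc 0 \<in> out_edges G v" using Cons.prems(1) by (auto simp: directed_path_def)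
    then have "hd es' \<in> out_edges G v" using es by (cases es') auto
    then show ?thesis using \<open>v \<in> V\<close> S'(2) by (auto simp: out_edges_def incident_def)
  qed
  moreover have "last es' \<in> E" using Cons.prems(3) es by (cases es') auto
  ultimately show ?case using Cons.IH[OF path'] es e by auto
qed

lemma directed_tree_sSb_eq_Emb:
  assumes G: "directed_tree G"
  shows "sSb G = Emb G"
proof -
  have "convex_inclusion H G h \<longleftrightarrow> embedding H G h" for H h
    using embedding_inj_on_edges[OF G, of H h] embeddingD(7)[of H G h]
      directed_path_in_subtree[OF G embedding_image_subtree[of H G h]]
    unfolding convex_inclusion_def by blast
  then show ?thesis
    unfolding sSb_def by (blast intro: emb_class_in_Emb elim: Emb_cases)
qed


section \<open>Comparison of the morphisms\<close>

text \<open>A partition of one side is extended to \<open>V\<close> by adding the whole other side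
  to the block that contains the end of \<open>x\<close>. Then \<open>x\<close> does not cross, so
  the crossing edge supplied by \<open>V\<close> runs within the side in question.\<close>

lemma edge_cut_split_vconnected:
  assumes cut: "edge_cut G x A" and V: "vconnected G V" "src G x \<in> V" "tgt G x \<in> V"
  shows "vconnected G (V \<inter> A)" "vconnected G (V - A)"
proof -
  have x: "src G x \<in> A" "tgt G x \<notin> A"
    and cut': "\<And>y. \<lbrakk>y \<in> inner_edges G; y \<noteq> x\<rbrakk> \<Longrightarrow> (src G y \<in> A) = (tgt G y \<in> A)"
    using cut by (auto simp: edge_cut_def)
  show "vconnected G (V \<inter> A)"
    unfolding vconnected_def
  proof (intro allI impI)
    fix P assume P: "V \<inter> A \<inter> P \<noteq> {} \<and> V \<inter> A - P \<noteq> {}"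
    \<comment> \<open>\<open>Q\<close> is the block that misses the source of
      \<open>x\<close>.\<close>
    define Q where "Q = (if src G x \<in> P then V \<inter> A - P else V \<inter> A \<inter> P)"
    have "V \<inter> Q \<noteq> {}" using P by (auto simp: Q_def)
    moreover have "V - Q \<noteq> {}" using V(2) x(1) by (auto simp: Q_def split: if_splits)
    ultimately obtain e where e: "e \<in> inner_edges G" "src G e \<in> V" "tgt G e \<in> V"
      "(src G e \<in> Q) \<noteq> (tgt G e \<in> Q)"
      by (rule vconnectedD[OF V(1)])
    have "e \<noteq> x" using e(4) x by (auto simp: Q_def split: if_splits)
    then have "(src G e \<in> A) = (tgt G e \<in> A)" using cut' e(1) by blast
    then show "\<exists>e\<in>inner_edges G. src G e \<in> V \<inter> A \<and> tgt G e \<in> V \<inter> A \<and>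
        (src G e \<in> P) \<noteq> (tgt G e \<in> P)"
      using e by (intro bexI[of _ e]) (auto simp: Q_def split: if_splits)
  qed
  show "vconnected G (V - A)"
    unfolding vconnected_def
  proof (intro allI impI)
    fix P assume P: "(V - A) \<inter> P \<noteq> {} \<and> V - A - P \<noteq> {}"
    define Q where "Q = (if tgt G x \<in> P then V - A - P else (V - A) \<inter> P)"
    have "V \<inter> Q \<noteq> {}" using P by (auto simp: Q_def)
    moreover have "V - Q \<noteq> {}" using V(3) x(2) by (auto simp: Q_def split: if_splits)
    ultimately obtain e where e: "e \<in> inner_edges G" "src G e \<in> V" "tgt G e \<in> V"
      "(src G e \<in> Q) \<noteq> (tgt G e \<in> Q)"
      by (rule vconnectedD[OF V(1)])
    have "e \<noteq> x" using e(4) x by (auto simp: Q_def split: if_splits)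
    then have "(src G e \<in> A) = (tgt G e \<in> A)" using cut' e(1) by blast
    then show "\<exists>e\<in>inner_edges G. src G e \<in> V - A \<and> tgt G e \<in> V - A \<and>
        (src G e \<in> P) \<noteq> (tgt G e \<in> P)"
      using e by (intro bexI[of _ e]) (auto simp: Q_def split: if_splits)
  qed
qed

text \<open>Take \<open>U\<close> maximal among the connected sets around \<open>T\<close> that
  avoid \<open>S\<close>. Some inner edge leaves \<open>U\<close>, and adding its outer end keeps
  \<open>U\<close> connected, so by maximality that end lies in \<open>S\<close>. This edge becomes
  the shared leg in \<open>G_Hom_vertex_disjoint\<close>.\<close>

lemma vconnected_extend_to_neighbour:
  assumes G: "connected_graph G" and S: "S \<subseteq> verts G" "S \<noteq> {}"
    and T: "T \<subseteq> verts G" "T \<noteq> {}" "vconnected G T" "S \<inter> T = {}"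
  obtains U x where "T \<subseteq> U" "U \<subseteq> verts G" "vconnected G U" "S \<inter> U = {}" "x \<in> inner_edges G"
    "src G x \<in> S \<and> tgt G x \<in> U \<or> src G x \<in> U \<and> tgt G x \<in> S"
proof -
  let ?F = "{U. T \<subseteq> U \<and> U \<subseteq> verts G - S \<and> vconnected G U}"
  have "digraph G" using G by (simp add: connected_graph_def)
  then have "finite (Pow (verts G))" by (simp add: digraphD(2))
  then have "finite ?F" by (rule rev_finite_subset) auto
  moreover have "T \<in> ?F" using T by auto
  then have "?F \<noteq> {}" by (metis empty_iff)
  ultimately have "\<exists>U \<in> ?F. \<forall>W \<in> ?F. U \<subseteq> W \<longrightarrow> U = W" by (rule finite_has_maximal)
  then obtain U where U: "U \<in> ?F" and max: "\<forall>W \<in> ?F. U \<subseteq> W \<longrightarrow> U = W" by (rule bexE)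
  have "verts G \<inter> U \<noteq> {}" "verts G - U \<noteq> {}" using U T S by auto
  then obtain x where x: "x \<in> inner_edges G" "src G x \<in> verts G" "tgt G x \<in> verts G"
    "(src G x \<in> U) \<noteq> (tgt G x \<in> U)"
    by (rule vconnectedD[OF connected_graph_imp_vconnected[OF G]])
  have ext: "w \<in> S" if w: "w \<in> verts G" "w \<notin> U" "{src G x, tgt G x} = {u, w}" "u \<in> U" for u w
  proof (rule ccontr)
    assume "w \<notin> S"
    have "vconnected G (insert w U)"
      unfolding vconnected_def
    proof (intro allI impI)
      fix A assume A: "insert w U \<inter> A \<noteq> {} \<and> insert w U - A \<noteq> {}"
      show "\<exists>e\<in>inner_edges G. src G e \<in> insert w U \<and> tgt G e \<in> insert w U \<and>
          (src G e \<in> A) \<noteq> (tgt G e \<in> A)"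
      proof (cases "U \<inter> A \<noteq> {} \<and> U - A \<noteq> {}")
        case True
        have "vconnected G U" using U by simp
        then obtain e where "e \<in> inner_edges G" "src G e \<in> U" "tgt G e \<in> U"
          "(src G e \<in> A) \<noteq> (tgt G e \<in> A)"
          using vconnectedD[of G U A] True by metis
        then show ?thesis by blast
      next
        \<comment> \<open>\<open>A\<close> does not split \<open>U\<close>, so it separates
          \<open>w\<close> from all of \<open>U\<close>, and \<open>x\<close> crosses.\<close>
        case False
        then have "(u \<in> A) \<noteq> (w \<in> A)" using A w(4) by blast
        then show ?thesis
          using x(1) w by (intro bexI[of _ x]) (auto simp: doubleton_eq_iff)
      qed
    qed
    then have "insert w U \<in> ?F" using U w(1) \<open>w \<notin> S\<close> by auto
    then have "U = insert w U" by (rule max[rule_format]) blast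
    then show False using w(2) by blast
  qed
  have "src G x \<in> S \<and> tgt G x \<in> U \<or> src G x \<in> U \<and> tgt G x \<in> S"
    using x ext[of "src G x" "tgt G x"] ext[of "tgt G x" "src G x"] by auto
  then show thesis using that[of U x] U x(1) by auto
qed

section \<open>Morphisms preserve edges and vertex disjointness\<close>

lemma set_emb_legs:
  assumes G: "directed_tree G" and c: "c \<in> Emb G"
  shows "set_mset (emb_in c) = sub_in_legs G (emb_edges c) (emb_verts c)"
    "set_mset (emb_out c) = sub_out_legs G (emb_edges c) (emb_verts c)"
    "set_mset (emb_in c) \<subseteq> edges G" "set_mset (emb_out c) \<subseteq> edges G"
proof -
  note dG = directed_treeD(2)[OF G]
  have E: "emb_edges c \<subseteq> edges G" using subtree_subset_edges[OF dG Emb_subtree[OF G c]] .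
  then have "finite (emb_edges c)" using digraphD(1)[OF dG] finite_subset by blast
  then show s: "set_mset (emb_in c) = sub_in_legs G (emb_edges c) (emb_verts c)"
    "set_mset (emb_out c) = sub_out_legs G (emb_edges c) (emb_verts c)"
    by (simp_all add: emb_legs[OF G c] sub_in_legs_def sub_out_legs_def)
  show "set_mset (emb_in c) \<subseteq> edges G" "set_mset (emb_out c) \<subseteq> edges G"
    using E by (auto simp: s sub_in_legs_def sub_out_legs_def)
qed

lemma emb_legs_edge:
  assumes G: "directed_tree G" and c: "c \<in> Emb G" "emb_verts c = {}" "emb_edges c = {e}"
  shows "emb_in c = {#e#}" "emb_out c = {#e#}"
  using c by (simp_all add: emb_legs[OF G c(1)] sub_in_legs_def sub_out_legs_def)

text \<open>An input leg that is also an output leg has no end in the vertex set, whereas a subtree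
  with vertices consists of edges incident to them.\<close>

lemma edge_if_emb_legs_eq:
  assumes G: "directed_tree G" and c: "c \<in> Emb G" and legs: "emb_in c = {#x#}" "emb_out c = {#x#}"
  shows "emb_verts c = {}" "emb_edges c = {x}"
proof -
  have *: "sub_in_legs G (emb_edges c) (emb_verts c) = {x}"
    "sub_out_legs G (emb_edges c) (emb_verts c) = {x}"
    using set_emb_legs(1,2)[OF G c] legs by auto
  have "x \<in> emb_edges c" "x \<notin> incident G (emb_verts c)"
    using * by (auto simp: sub_in_legs_def sub_out_legs_def incident_def)
  then show "emb_verts c = {}" using Emb_subtree[OF G c] by (auto simp: subtree_def)
  then show "emb_edges c = {x}" using * by (auto simp: sub_in_legs_def)
qed

text \<open>The cut at the common leg separates the two subtrees.\<close>

lemma vertex_disjoint_if_common_leg: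
  assumes G: "directed_tree G" and c: "c \<in> Emb G" and d: "d \<in> Emb G"
    and x: "x \<in># emb_out c" "x \<in># emb_in d"
  shows "vertex_disjoint c d"
proof (cases "emb_verts c = {} \<or> emb_verts d = {}")
  case True
  then show ?thesis by (auto simp: vertex_disjoint_def)
next
  case False
  then have sub: "vconnected G (emb_verts c)" "emb_edges c = incident G (emb_verts c)"
    "vconnected G (emb_verts d)" "emb_edges d = incident G (emb_verts d)"
    using Emb_subtree[OF G c] Emb_subtree[OF G d] by (auto simp: subtree_def)
  have "x \<in> sub_out_legs G (emb_edges c) (emb_verts c)" "x \<in> sub_in_legs G (emb_edges d) (emb_verts d)"
    using x set_emb_legs(1)[OF G d] set_emb_legs(2)[OF G c] by auto
  \<comment> \<open>In the presence of vertices, an output leg has its source among them and an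
    input leg its target, so \<open>x\<close> is inner and points from \<open>c\<close> to
    \<open>d\<close>.\<close>
  then have ends: "src G x \<in> emb_verts c" "tgt G x \<notin> emb_verts c" "x \<in> inner_edges G"
    "tgt G x \<in> emb_verts d" "src G x \<notin> emb_verts d"
    using sub by (auto simp: sub_in_legs_def sub_out_legs_def incident_def inner_edges_def)
  obtain A where A: "edge_cut G x A" using directed_tree_edge_cut[OF G ends(3)] .
  have "emb_verts c \<subseteq> A" by (rule edge_cut_vconnected_source_side[OF A sub(1) ends(1,2)])
  moreover have "emb_verts d \<inter> A = {}" by (rule edge_cut_vconnected_target_side[OF A sub(3) ends(4,5)])
  ultimately show ?thesis by (auto simp: vertex_disjoint_def)
qed

lemma G_Hom_edge:
  assumes G: "directed_tree G" and G': "directed_tree G'" and f: "f \<in> G_Hom G G'"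
    and h: "h \<in> Emb G" "emb_verts h = {}"
  shows "snd f h \<in> Emb G'" "emb_verts (snd f h) = {}"
proof -
  obtain e where e: "emb_edges h = {e}" using Emb_subtree[OF G h(1)] h(2) by (auto simp: subtree_def)
  show *: "snd f h \<in> Emb G'"
    using f h(1) unfolding G_Hom_def directed_tree_sSb_eq_Emb[OF G] directed_tree_sSb_eq_Emb[OF G']
    by auto
  have "emb_in (snd f h) = image_mset (fst f) (emb_in h)"
    "emb_out (snd f h) = image_mset (fst f) (emb_out h)"
    using f h(1) unfolding G_Hom_def directed_tree_sSb_eq_Emb[OF G] by auto
  then show "emb_verts (snd f h) = {}"
    using edge_if_emb_legs_eq(1)[OF G' *] emb_legs_edge[OF G h e] by simp
qed

text \<open>For disjoint subtrees with vertices, one of them can be enlarged until it shares a leg with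
  the other; the images of the two then share the image of that leg.\<close>

lemma G_Hom_vertex_disjoint:
  assumes G: "directed_tree G" and G': "directed_tree G'" and f: "f \<in> G_Hom G G'"
    and h: "h \<in> Emb G" and k: "k \<in> Emb G" and disj: "vertex_disjoint h k"
  shows "vertex_disjoint (snd f h) (snd f k)"
proof (cases "emb_verts h = {} \<or> emb_verts k = {}")
  case True
  then show ?thesis
    using G_Hom_edge(2)[OF G G' f h] G_Hom_edge(2)[OF G G' f k] by (auto simp: vertex_disjoint_def)
next
  case False
  have Emb': "snd f c \<in> Emb G'" if "c \<in> Emb G" for c
    using f that
    unfolding G_Hom_def directed_tree_sSb_eq_Emb[OF G] directed_tree_sSb_eq_Emb[OF G'] by auto
  have legs: "emb_in (snd f c) = image_mset (fst f) (emb_in c)"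
    "emb_out (snd f c) = image_mset (fst f) (emb_out c)" if "c \<in> Emb G" for c
    using f that unfolding G_Hom_def directed_tree_sSb_eq_Emb[OF G] by auto
  have union: "is_subgraph_union (snd f l) (snd f a) (snd f b)"
    if "l \<in> Emb G" "a \<in> Emb G" "b \<in> Emb G" "is_subgraph_union l a b" for l a b
    using f that unfolding G_Hom_def directed_tree_sSb_eq_Emb[OF G] by auto
  have sh: "emb_verts h \<subseteq> verts G" "emb_verts h \<noteq> {}" "emb_edges h = incident G (emb_verts h)"
    using Emb_subtree[OF G h] False by (auto simp: subtree_def)
  have sk: "emb_verts k \<subseteq> verts G" "emb_verts k \<noteq> {}" "vconnected G (emb_verts k)"
    "emb_edges k = incident G (emb_verts k)"
    using Emb_subtree[OF G k] False by (auto simp: subtree_def)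
  obtain U x where U: "emb_verts k \<subseteq> U" "U \<subseteq> verts G" "vconnected G U" "emb_verts h \<inter> U = {}"
    and x: "x \<in> inner_edges G"
      "src G x \<in> emb_verts h \<and> tgt G x \<in> U \<or> src G x \<in> U \<and> tgt G x \<in> emb_verts h"
    using vconnected_extend_to_neighbour[OF directed_treeD(1)[OF G] sh(1,2) sk(1,2,3)] disj
    unfolding vertex_disjoint_def by metis
  have "subtree G (incident G U) U" using U sk(2) by (auto simp: subtree_def)
  then obtain k' where k': "k' \<in> Emb G" "emb_edges k' = incident G U" "emb_verts k' = U"
    by (rule subtree_classE[OF G])
  \<comment> \<open>Preservation of this degenerate union yields monotonicity of the map.\<close>
  have "is_subgraph_union k' k k'"
    using incident_mono[OF U(1), of G] U(1) sk(4) by (auto simp: is_subgraph_union_def k')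
  then have le: "emb_verts (snd f k) \<subseteq> emb_verts (snd f k')"
    using union[OF k'(1) k k'(1)] by (auto simp: is_subgraph_union_def)
  have "x \<in># emb_out h \<and> x \<in># emb_in k' \<or> x \<in># emb_out k' \<and> x \<in># emb_in h"
    using x U(4)
    unfolding set_emb_legs(1,2)[OF G h] set_emb_legs(1,2)[OF G k'(1)] k'(2,3) sh(3)
    by (auto simp: sub_in_legs_def sub_out_legs_def incident_def inner_edges_def)
  then have "fst f x \<in># emb_out (snd f h) \<and> fst f x \<in># emb_in (snd f k') \<or>
      fst f x \<in># emb_out (snd f k') \<and> fst f x \<in># emb_in (snd f h)"
    using legs[OF h] legs[OF k'(1)] by auto
  then have "vertex_disjoint (snd f h) (snd f k')"
    using vertex_disjoint_if_common_leg[OF G' Emb'[OF h] Emb'[OF k'(1)]]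
      vertex_disjoint_if_common_leg[OF G' Emb'[OF k'(1)] Emb'[OF h]]
    by (auto simp: vertex_disjoint_def)
  then show ?thesis using le by (auto simp: vertex_disjoint_def)
qed

lemma directed_tree_G_Hom_eq_U_Hom:
  assumes G: "directed_tree G" and G': "directed_tree G'"
  shows "G_Hom G G' = U_Hom G G'"
proof (intro equalityI subsetI)
  note sSb = directed_tree_sSb_eq_Emb[OF G] directed_tree_sSb_eq_Emb[OF G']
  fix f assume f: "f \<in> G_Hom G G'"
  obtain f0 f1 where f01: "f = (f0, f1)" by (cases f)
  have f': "f0 \<in> edges G \<rightarrow>\<^sub>E edges G'" "f1 \<in> Emb G \<rightarrow>\<^sub>E Emb G'"
    "\<And>h. h \<in> Emb G \<Longrightarrow> emb_in (f1 h) = image_mset f0 (emb_in h) \<and> emb_out (f1 h) = image_mset f0 (emb_out h)"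
    "\<And>l h k. \<lbrakk>l \<in> Emb G; h \<in> Emb G; k \<in> Emb G; is_subgraph_union l h k\<rbrakk>
      \<Longrightarrow> is_subgraph_union (f1 l) (f1 h) (f1 k)"
    using f unfolding G_Hom_def sSb f01 by auto
  have Emb': "f1 h \<in> Emb G'" if "h \<in> Emb G" for h using f'(2) that by auto
  have "is_edge (f1 h)" if "h \<in> Emb G" "is_edge h" for h
    using G_Hom_edge(2)[OF G G' f that(1)] is_edge_iff[OF G that(1)] is_edge_iff[OF G' Emb'[OF that(1)]]
      that(2) by (simp add: f01)
  moreover have "is_union (f1 l) (f1 h) (f1 k)"
    if "l \<in> Emb G" "h \<in> Emb G" "k \<in> Emb G" "is_union l h k" for l h k
    using that f'(4)[OF that(1-3)] is_union_iff[OF G that(1-3)]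
      is_union_iff[OF G' Emb'[OF that(1)] Emb'[OF that(2)] Emb'[OF that(3)]] by simp
  moreover have "vertex_disjoint (f1 h) (f1 k)"
    if "h \<in> Emb G" "k \<in> Emb G" "vertex_disjoint h k" for h k
    using G_Hom_vertex_disjoint[OF G G' f that] by (simp add: f01)
  ultimately show "f \<in> U_Hom G G'" using f' by (simp add: U_Hom_def f01)
next
  note sSb = directed_tree_sSb_eq_Emb[OF G] directed_tree_sSb_eq_Emb[OF G']
  fix f assume f: "f \<in> U_Hom G G'"
  obtain f0 f1 where f01: "f = (f0, f1)" by (cases f)
  have f': "f0 \<in> edges G \<rightarrow>\<^sub>E edges G'" "f1 \<in> Emb G \<rightarrow>\<^sub>E Emb G'"
    "\<And>h. h \<in> Emb G \<Longrightarrow> emb_in (f1 h) = image_mset f0 (emb_in h) \<and> emb_out (f1 h) = image_mset f0 (emb_out h)"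
    "\<And>l h k. \<lbrakk>l \<in> Emb G; h \<in> Emb G; k \<in> Emb G; is_union l h k\<rbrakk>
      \<Longrightarrow> is_union (f1 l) (f1 h) (f1 k)"
    using f unfolding U_Hom_def f01 by auto
  have Emb': "f1 h \<in> Emb G'" if "h \<in> Emb G" for h using f'(2) that by auto
  have "is_subgraph_union (f1 l) (f1 h) (f1 k)"
    if "l \<in> Emb G" "h \<in> Emb G" "k \<in> Emb G" "is_subgraph_union l h k" for l h k
    using that f'(4)[OF that(1-3)] is_union_iff[OF G that(1-3)]
      is_union_iff[OF G' Emb'[OF that(1)] Emb'[OF that(2)] Emb'[OF that(3)]] by simp
  then show "f \<in> G_Hom G G'" using f' by (simp add: G_Hom_def sSb f01)
qed

section \<open>Morphisms are determined by their values on edges and stars\<close>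

lemma star_class_in_Emb:
  assumes "directed_tree G" "v \<in> verts G"
  shows "star_class G v \<in> Emb G" "emb_edges (star_class G v) = incident G {v}"
    "emb_verts (star_class G v) = {v}"
  unfolding star_class_eq using subtree_class[OF assms(1) subtree_vertex[OF assms(2)]] .

text \<open>A subtree with more than one vertex is cut at an inner edge into two smaller ones.\<close>

lemma U_Hom_eqI:
  assumes G: "directed_tree G" and G': "directed_tree G'"
    and f: "f \<in> U_Hom G G'" and g: "g \<in> U_Hom G G'" and fst: "fst f = fst g"
    and star: "\<And>v. v \<in> verts G \<Longrightarrow> snd f (star_class G v) = snd g (star_class G v)"
  shows "f = g"
proof (rule prod_eqI[OF fst])
  \<comment> \<open>As elements of \<open>G_Hom\<close> the morphisms preserve unions of subgraphs,
    which determine edges and vertices alike.\<close>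
  note f' = f[folded directed_tree_G_Hom_eq_U_Hom[OF G G']]
  note g' = g[folded directed_tree_G_Hom_eq_U_Hom[OF G G']]
  have Emb': "snd f c \<in> Emb G'" "snd g c \<in> Emb G'" if "c \<in> Emb G" for c
    using f g that unfolding U_Hom_def by auto
  have legs: "emb_in (snd f c) = image_mset (fst f) (emb_in c)"
    "emb_in (snd g c) = image_mset (fst g) (emb_in c)" if "c \<in> Emb G" for c
    using f g that unfolding U_Hom_def by auto
  have union: "is_subgraph_union (snd f l) (snd f a) (snd f b)"
    "is_subgraph_union (snd g l) (snd g a) (snd g b)"
    if "l \<in> Emb G" "a \<in> Emb G" "b \<in> Emb G" "is_subgraph_union l a b" for l a b
    using f' g' that unfolding G_Hom_def directed_tree_sSb_eq_Emb[OF G] by auto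
  have "snd f c = snd g c" if "c \<in> Emb G" for c
    using that
  proof (induction "card (emb_verts c)" arbitrary: c rule: less_induct)
    case less
    note c = less.prems
    let ?V = "emb_verts c"
    consider "?V = {}" | v where "?V = {v}" | a b where "a \<in> ?V" "b \<in> ?V" "a \<noteq> b" by blast
    then show ?case
    proof cases
      case 1
      obtain e where e: "emb_edges c = {e}" using Emb_subtree[OF G c] 1 by (auto simp: subtree_def)
      \<comment> \<open>An edge class is recovered from its single input leg, so the edge function
        fixes the values on edges.\<close>
      have edge: "emb_verts d = {} \<and> emb_edges d = {fst f e}"
        if d: "d \<in> Emb G'" "emb_verts d = {}" "emb_in d = {#fst f e#}" for d
      proof -
        obtain y where "emb_edges d = {y}" using Emb_subtree[OF G' d(1)] d(2) by (auto simp: subtree_def)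
        then show ?thesis using emb_legs_edge(1)[OF G' d(1,2)] d(2,3) by simp
      qed
      have "emb_in (snd f c) = {#fst f e#}" "emb_in (snd g c) = {#fst f e#}"
        using legs[OF c] emb_legs_edge(1)[OF G c 1 e] fst by simp_all
      then show ?thesis
        using edge[of "snd f c"] edge[of "snd g c"] Emb'[OF c]
          G_Hom_edge(2)[OF G G' f' c 1] G_Hom_edge(2)[OF G G' g' c 1]
        by (intro Emb_eqI[OF G']) simp_all
    next
      case (2 v)
      then have v: "v \<in> verts G" "emb_edges c = incident G {v}"
        using Emb_subtree[OF G c] by (auto simp: subtree_def)
      have "c = star_class G v"
        using star_class_in_Emb[OF G v(1)] 2 v(2) by (intro Emb_eqI[OF G c]) simp_all
      then show ?thesis using star[OF v(1)] by simp
    next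
      case (3 a b)
      then have sub: "?V \<subseteq> verts G" "vconnected G ?V" "emb_edges c = incident G ?V"
        using Emb_subtree[OF G c] by (auto simp: subtree_def)
      \<comment> \<open>Separating \<open>a\<close> only serves to find an inner edge within
        \<open>?V\<close>; the cut that is used is the one at this edge.\<close>
      have "?V \<inter> {a} \<noteq> {}" "?V - {a} \<noteq> {}" using 3 by auto
      then obtain x where x: "x \<in> inner_edges G" "src G x \<in> ?V" "tgt G x \<in> ?V"
        by (rule vconnectedD[OF sub(2)])
      obtain A where A: "edge_cut G x A" using directed_tree_edge_cut[OF G x(1)] .
      note split = edge_cut_split_vconnected[OF A sub(2) x(2,3)]
      have xA: "src G x \<in> A" "tgt G x \<notin> A" using A by (auto simp: edge_cut_def)
      have "subtree G (incident G (?V \<inter> A)) (?V \<inter> A)" "subtree G (incident G (?V - A)) (?V - A)"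
        using split sub(1) x xA by (auto simp: subtree_def)
      then obtain c1 c2 where c1: "c1 \<in> Emb G" "emb_edges c1 = incident G (?V \<inter> A)" "emb_verts c1 = ?V \<inter> A"
        and c2: "c2 \<in> Emb G" "emb_edges c2 = incident G (?V - A)" "emb_verts c2 = ?V - A"
        using subtree_classE[OF G] by metis
      have "finite ?V" using sub(1) digraphD(2)[OF directed_treeD(2)[OF G]] finite_subset by blast
      \<comment> \<open>Each part misses one end of \<open>x\<close>.\<close>
      then have "card (emb_verts c1) < card ?V" "card (emb_verts c2) < card ?V"
        using x xA by (auto simp: c1 c2 intro!: psubset_card_mono)
      then have IH: "snd f c1 = snd g c1" "snd f c2 = snd g c2"
        using less.hyps c1(1) c2(1) by blast+
      have "?V = (?V \<inter> A) \<union> (?V - A)" by blast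
      then have "is_subgraph_union c c1 c2"
        unfolding is_subgraph_union_def c1(2,3) c2(2,3) sub(3) incident_Un[symmetric] by simp
      from union[OF c c1(1) c2(1) this] show ?thesis
        by (intro Emb_eqI[OF G' Emb'[OF c]]) (simp_all add: is_subgraph_union_def IH)
    qed
  qed
  moreover have "snd f \<in> extensional (Emb G)" "snd g \<in> extensional (Emb G)"
    using f g by (auto simp: U_Hom_def PiE_iff)
  ultimately show "snd f = snd g" using extensionalityI by blast
qed

text \<open>The morphism itself fits the definite description, and \<open>U_Hom_eqI\<close> makes it
  the only one.\<close>

lemma mor_map_G_to_U:
  assumes G: "directed_tree G" and G': "directed_tree G'" and f: "f \<in> U_Hom G G'"
  shows "mor_map G_to_U G G' f = f"
  unfolding G_to_U_def ftor.simps
  by (rule the_equality) (use f U_Hom_eqI[OF G G'] in auto)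

section \<open>The equivalence\<close>

text \<open>The two categories are not assumed equal as records, since their data may differ off the
  objects, as \<open>sSb\<close> and \<open>Emb\<close> can for graphs that are not trees. The
  quasi-inverse is \<open>id_ftor\<close>, and identities are the components of both natural
  isomorphisms.\<close>

lemma cat_equivalence_identity_like:
  fixes C D :: "('o, 'm) cat"
  assumes C: "category C" and D: "category D" and Ob: "Ob C = Ob D"
    and Hom: "\<And>a b. \<lbrakk>a \<in> Ob D; b \<in> Ob D\<rbrakk> \<Longrightarrow> Hom C a b = Hom D a b"
    and Comp: "\<And>a b c f g. \<lbrakk>a \<in> Ob D; b \<in> Ob D; c \<in> Ob D; f \<in> Hom D a b; g \<in> Hom D b c\<rbrakk>
      \<Longrightarrow> Comp C a b c g f = Comp D a b c g f"
    and Ident: "\<And>a. a \<in> Ob D \<Longrightarrow> Ident C a = Ident D a"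
    and F: "\<And>a. a \<in> Ob D \<Longrightarrow> ob_map F a = a"
      "\<And>a b f. \<lbrakk>a \<in> Ob D; b \<in> Ob D; f \<in> Hom D a b\<rbrakk> \<Longrightarrow> mor_map F a b f = f"
  shows "cat_equivalence C D F"
proof -
  have IdD: "Ident D a \<in> Hom D a a" if "a \<in> Ob D" for a
    using category.Ident_in_Hom[OF D that] .
  have CoD: "Comp D a b c g f \<in> Hom D a c"
    if "a \<in> Ob D" "b \<in> Ob D" "c \<in> Ob D" "f \<in> Hom D a b" "g \<in> Hom D b c" for a b c f g
    using category.Comp_in_Hom[OF D that] .
  note cat = category.Comp_Ident_left[OF D] category.Comp_Ident_right[OF D]
  have FCD: "cat_functor C D F"
    by (intro cat_functor.intro cat_functor_axioms.intro C D)
      (simp_all add: Ob Hom Comp Ident F IdD CoD)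
  have FDC: "cat_functor D C id_ftor"
    by (intro cat_functor.intro cat_functor_axioms.intro C D)
      (simp_all add: Ob Hom Comp Ident id_ftor_def)
  have idC: "cat_functor C C id_ftor" and idD: "cat_functor D D id_ftor"
    by (intro cat_functor.intro cat_functor_axioms.intro C D; simp add: id_ftor_def)+
  have GF: "cat_functor C C (comp_ftor id_ftor F)" and FG: "cat_functor D D (comp_ftor F id_ftor)"
    by (intro cat_functor.intro cat_functor_axioms.intro C D;
        simp add: id_ftor_def comp_ftor_def Ob Hom Comp Ident F IdD CoD)+
  have iso: "cat_iso D a a (Ident D a)" if "a \<in> Ob D" for a
    unfolding cat_iso_def using IdD[OF that] cat[OF that that] by blast
  have isoC: "cat_iso C a a (Ident D a)" if "a \<in> Ob D" for a
    using iso[OF that] unfolding cat_iso_def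
    by (simp add: Hom Ident that) (metis Comp that)
  have "natural_iso C C id_ftor (comp_ftor id_ftor F) (Ident D)"
    by (intro natural_iso.intro natural_iso_axioms.intro idC GF)
      (simp_all add: id_ftor_def comp_ftor_def Ob Hom Comp F IdD isoC cat)
  moreover have "natural_iso D D (comp_ftor F id_ftor) id_ftor (Ident D)"
    by (intro natural_iso.intro natural_iso_axioms.intro idD FG)
      (simp_all add: id_ftor_def comp_ftor_def F iso cat)
  ultimately show ?thesis
    using FCD FDC by (intro cat_equivalence.intro cat_equivalence_axioms.intro) blast+
qed

section \<open>Category laws and conclusion\<close>

lemma U0_cat_simps:
  "a \<in> Ob U0_cat \<longleftrightarrow> directed_tree a" "Hom U0_cat = U_Hom"
  "Comp U0_cat a b c g f = (compose (edges a) (fst g) (fst f), compose (Emb a) (snd g) (snd f))"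
  "Ident U0_cat a = (\<lambda>e \<in> edges a. e, \<lambda>h \<in> Emb a. h)"
  by (auto simp: U0_cat_def U_cat_def full_subcat_def directed_treeD)

lemma Gsc_cat_simps:
  "a \<in> Ob Gsc_cat \<longleftrightarrow> directed_tree a" "Hom Gsc_cat = G_Hom"
  "Comp Gsc_cat a b c g f = (compose (edges a) (fst g) (fst f), compose (sSb a) (snd g) (snd f))"
  "Ident Gsc_cat a = (\<lambda>e \<in> edges a. e, \<lambda>h \<in> sSb a. h)"
  by (auto simp: Gsc_cat_def G_cat_def full_subcat_def directed_tree_imp_acyclic)

lemma U_Hom_Ident:
  assumes G: "directed_tree G"
  shows "(\<lambda>e \<in> edges G. e, \<lambda>h \<in> Emb G. h) \<in> U_Hom G G"
proof -
  \<comment> \<open>The restricted identity is \<open>undefined\<close> off \<open>edges G\<close>,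
    so the support matters; legs satisfy it by \<open>set_emb_legs\<close>.\<close>
  have "image_mset (\<lambda>e \<in> edges G. e) M = M" if "set_mset M \<subseteq> edges G" for M
  proof -
    have "image_mset (\<lambda>e \<in> edges G. e) M = image_mset (\<lambda>e. e) M"
      using that by (intro image_mset_cong) auto
    then show ?thesis by simp
  qed
  then show ?thesis using set_emb_legs(3,4)[OF G] by (simp add: U_Hom_def)
qed

lemma U_Hom_Comp:
  assumes G: "directed_tree G" and f: "f \<in> U_Hom G G'" and g: "g \<in> U_Hom G' G''"
  shows "(compose (edges G) (fst g) (fst f), compose (Emb G) (snd g) (snd f)) \<in> U_Hom G G''"
proof -
  obtain f0 f1 g0 g1 where fg: "f = (f0, f1)" "g = (g0, g1)" by (cases f; cases g)
  note f' = f[unfolded fg U_Hom_def mem_Collect_eq prod.case]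
  note g' = g[unfolded fg U_Hom_def mem_Collect_eq prod.case]
  have f1: "f1 h \<in> Emb G'" if "h \<in> Emb G" for h using f' that by auto
  have comp: "image_mset (compose (edges G) g0 f0) M = image_mset g0 (image_mset f0 M)"
    if "set_mset M \<subseteq> edges G" for M
    using that by (auto simp: image_mset.compositionality compose_eq intro!: image_mset_cong)
  have "compose (edges G) g0 f0 \<in> edges G \<rightarrow>\<^sub>E edges G''" "compose (Emb G) g1 f1 \<in> Emb G \<rightarrow>\<^sub>E Emb G''"
    using f' g' by (auto simp: compose_def)
  moreover have "emb_in (g1 (f1 h)) = image_mset (compose (edges G) g0 f0) (emb_in h)"
    "emb_out (g1 (f1 h)) = image_mset (compose (edges G) g0 f0) (emb_out h)" if "h \<in> Emb G" for h
    using f' g' f1[OF that] that comp set_emb_legs(3,4)[OF G that] by simp_all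
  ultimately show ?thesis
    using f' g' f1 by (simp add: U_Hom_def fg compose_eq)
qed

lemma U_HomD:
  assumes "f \<in> U_Hom G G'"
  shows "fst f \<in> edges G \<rightarrow> edges G'" "fst f \<in> extensional (edges G)"
    "snd f \<in> Emb G \<rightarrow> Emb G'" "snd f \<in> extensional (Emb G)"
  using assms by (auto simp: U_Hom_def PiE_def)

lemma category_U0_cat: "category U0_cat"
proof
  fix a b f assume "a \<in> Ob U0_cat" "b \<in> Ob U0_cat" "f \<in> Hom U0_cat a b"
  then have f: "f \<in> U_Hom a b" by (simp add: U0_cat_simps)
  show "Comp U0_cat a b b (Ident U0_cat b) f = f"
    using U_HomD[OF f] by (simp add: U0_cat_simps Id_compose)
  show "Comp U0_cat a a b f (Ident U0_cat a) = f"
    using U_HomD[OF f] by (simp add: U0_cat_simps compose_Id)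
next
  fix a b c d f g h
  assume "a \<in> Ob U0_cat" "b \<in> Ob U0_cat" "c \<in> Ob U0_cat" "d \<in> Ob U0_cat"
    "f \<in> Hom U0_cat a b" "g \<in> Hom U0_cat b c" "h \<in> Hom U0_cat c d"
  then show "Comp U0_cat a b d (Comp U0_cat b c d h g) f = Comp U0_cat a c d h (Comp U0_cat a b c g f)"
    using U_HomD[of f a b] by (simp add: U0_cat_simps compose_assoc)
qed (simp_all add: U0_cat_simps U_Hom_Ident U_Hom_Comp)

text \<open>The laws are transported from \<open>U0_cat\<close>, whose morphisms, composition and
  identities agree on directed trees.\<close>

lemma category_Gsc_cat: "category (Gsc_cat :: (('e, 'v) dgraph, ('e, 'v) gmor) cat)"
proof -
  have eq: "Hom Gsc_cat a b = Hom U0_cat a b" "Ident Gsc_cat a = Ident U0_cat a"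
    "Comp Gsc_cat a b c = Comp U0_cat a b c"
    if "a \<in> Ob U0_cat" "b \<in> Ob U0_cat" for a b c :: "('e, 'v) dgraph"
    using that
    by (auto simp: fun_eq_iff U0_cat_simps Gsc_cat_simps directed_tree_sSb_eq_Emb
        directed_tree_G_Hom_eq_U_Hom)
  have Ob: "a \<in> Ob Gsc_cat \<longleftrightarrow> a \<in> Ob U0_cat" for a :: "('e, 'v) dgraph"
    by (simp add: U0_cat_simps Gsc_cat_simps)
  interpret U0: category U0_cat by (rule category_U0_cat)
  show ?thesis
    by unfold_locales
      (simp_all add: Ob eq U0.Ident_in_Hom U0.Comp_in_Hom U0.Comp_Ident_left U0.Comp_Ident_right
        U0.Comp_assoc)
qed

theorem corollaryB21:
  shows "cat_equivalence
    (Gsc_cat :: (('e::infinite, 'v::infinite) dgraph, ('e, 'v) gmor) cat)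
    (U0_cat :: (('e, 'v) dgraph, ('e, 'v) gmor) cat)
    G_to_U"
proof (rule cat_equivalence_identity_like[OF category_Gsc_cat category_U0_cat])
  show "Ob Gsc_cat = Ob U0_cat" by (auto simp: U0_cat_simps Gsc_cat_simps)
qed (simp_all add: U0_cat_simps Gsc_cat_simps directed_tree_sSb_eq_Emb directed_tree_G_Hom_eq_U_Hom
    mor_map_G_to_U, simp add: G_to_U_def)

end
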